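(* Let $\mathcal{G}$ be a square polynomial system of $n$ polynomials in $\mathbb{C}[x_1,\dots,x_n]$ with a zero at $z^\ast\in\mathbb{C}^n$, and suppose that $z^\ast$ is a regular zero of breadth $\kappa$ and order $d$ of $\mathcal{G}$. Then there is a locally invertible transformation, i.e., a polynomial map $\Phi:\mathbb{C}^n\to\mathbb{C}^n$ with $\Phi(0)=z^\ast$ that is locally invertible near $0$, together with an $n\times n$ matrix $U$ of polynomials in $\mathbb{C}[x_1,\dots,x_n]$ with $U(0)$ invertible, such that the polynomial system $\mathcal{P}=\{p_1,\dots,p_n\}:=U\cdot(\mathcal{G}\circ\Phi)$ has the origin as a regular zero of breadth $\kappa$ and order $d$, is $(\kappa,d,d)$-pre-inflatable, and satisfies: (1) the initial degree of $p_i$ equals $d$ for each $1\le i\le\kappa$; (2) the initial forms of $p_1,\dots,p_\kappa$ have no common zero on the unit sphere in the variables $x_1,\dots,x_\kappa$ (i.e. at points $(x_1,\dots,x_\kappa,0,\dots,0)$ of Hermitian norm $1$); (3) the initial form of $p_i$ is $x_i$ for each $\kappa+1\le i\le n$.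
   Context: A square system is a system of $n$ polynomials in $n$ variables over $\mathbb{C}$, regarded as a column vector of polynomials. The initial form of a nonzero polynomial is its homogeneous part of smallest total degree; this smallest degree is the initial degree. The breadth of a system at a zero is the nullity of its Jacobian at that zero. Local Hilbert series at the origin: fix a graded local order on monomials, i.e., a total order compatible with multiplication such that $|\alpha|>|\beta|$ implies $x^\alpha<x^\beta$. The initial term of a polynomial is its largest monomial. The standard monomials of an ideal $I$ are the monomials which are not initial terms of elements of $I$; $h(i)$ is the number of standard monomials of total degree $i$, and the Hilbert series is $\sum_{i\ge0}h(i)t^i$. Regular zero: let the origin be an isolated zero of breadth $\kappa$ of a square system $\mathcal{P}$. The origin is a regular zero of breadth $\kappa$ and order $d$ if the local Hilbert series of $\langle\mathcal{P}\rangle$ at the origin is $(1+t+\dots+t^{d-1})^\kappa$. For a zero $z^\ast\neq 0$ the notion is defined by translating $z^\ast$ to the origin. Pre-inflatable: a square system $\mathcal{P}=\{p_1,\dots,p_n\}$ with an isolated zero at the origin is $(\kappa,k,\ell)$-pre-inflatable if (i) its Jacobian at the origin has kernel spanned by the standard basis vectors $e_1,\dots,e_\kappa$ (so the breadth is $\kappa$); (ii) every term of $p_1,\dots,p_\kappa$ involving at least one of $x_{\kappa+1},\dots,x_n$ has degree greater than $k$; (iii) every term of $p_{\kappa+1},\dots,p_n$ involving only $x_1,\dots,x_\kappa$ has degree greater than $\ell$. *)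

theory Defs
  imports "HOL-Analysis.Analysis" "HOL-Library.Poly_Mapping" "HOL-Computational_Algebra.Formal_Power_Series"
begin

text \<open>
  The variables are indexed by a finite linearly ordered type \<open>'n\<close>, so the number of variables
  is \<open>CARD('n)\<close> and the order of \<open>'n\<close> fixes the numbering of the variables.
\<close>

type_synonym 'n monom = "'n \<Rightarrow>\<^sub>0 nat"
type_synonym 'n mpoly = "'n monom \<Rightarrow>\<^sub>0 complex"
type_synonym 'n system = "('n mpoly)^'n"
type_synonym 'n pmatrix = "('n mpoly)^'n^'n"
type_synonym 'n point = "complex^'n"

text \<open>
  The position of an index, counted from \<open>0\<close>: the variables numbered 1 to \<open>\<kappa>\<close> are those
  \<open>i\<close> with \<open>pos i < \<kappa>\<close>.
\<close>
definition pos :: "'n::{finite,linorder} \<Rightarrow> nat"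
  where "pos i = card {..<i}"

definition mdeg :: "'n::finite monom \<Rightarrow> nat"
  where "mdeg m = (\<Sum>i\<in>UNIV. Poly_Mapping.lookup m i)"

definition Const :: "complex \<Rightarrow> 'n mpoly"
  where "Const c = Poly_Mapping.single 0 c"

definition Var :: "'n \<Rightarrow> 'n mpoly"
  where "Var i = Poly_Mapping.single (Poly_Mapping.single i 1) 1"

definition peval :: "'n::finite mpoly \<Rightarrow> complex^'n \<Rightarrow> complex"
  where "peval p x = (\<Sum>m\<in>Poly_Mapping.keys p.
    Poly_Mapping.lookup p m * (\<Prod>i\<in>UNIV. (x $ i) ^ Poly_Mapping.lookup m i))"

definition psubst :: "'n::finite mpoly \<Rightarrow> 'n system \<Rightarrow> 'n mpoly"
  where "psubst p \<Phi> = (\<Sum>m\<in>Poly_Mapping.keys p.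
    Const (Poly_Mapping.lookup p m) * (\<Prod>i\<in>UNIV. (\<Phi> $ i) ^ Poly_Mapping.lookup m i))"

definition ppartial :: "'n \<Rightarrow> 'n mpoly \<Rightarrow> 'n mpoly"
  where "ppartial j p =
    (\<Sum>m\<in>Poly_Mapping.keys p.
      Poly_Mapping.single (m - Poly_Mapping.single j 1)
        (of_nat (Poly_Mapping.lookup m j) * Poly_Mapping.lookup p m))"

definition sys_eval :: "'n::finite system \<Rightarrow> complex^'n \<Rightarrow> complex^'n"
  where "sys_eval P x = (\<chi> i. peval (P $ i) x)"

definition sys_comp :: "'n::finite system \<Rightarrow> 'n system \<Rightarrow> 'n system"
  where "sys_comp P \<Phi> = (\<chi> i. psubst (P $ i) \<Phi>)"

definition mat_eval :: "'n::finite pmatrix \<Rightarrow> complex^'n \<Rightarrow> complex^'n^'n"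
  where "mat_eval U x = (\<chi> i j. peval (U $ i $ j) x)"

definition jacobian :: "'n::finite system \<Rightarrow> complex^'n \<Rightarrow> complex^'n^'n"
  where "jacobian P z = (\<chi> i j. peval (ppartial j (P $ i)) z)"

definition jacobian_kernel :: "'n::finite system \<Rightarrow> complex^'n \<Rightarrow> (complex^'n) set"
  where "jacobian_kernel P z = {v. jacobian P z *v v = 0}"

definition breadth :: "'n::finite system \<Rightarrow> complex^'n \<Rightarrow> nat"
  where "breadth P z = vec.dim (jacobian_kernel P z)"

definition isolated_zero :: "'n::finite system \<Rightarrow> complex^'n \<Rightarrow> bool"
  where "isolated_zero P z \<longleftrightarrow> z isolated_in {x. sys_eval P x = 0}"

definition sys_ideal :: "'n::finite system \<Rightarrow> 'n mpoly set"
  where "sys_ideal P = {\<Sum>i\<in>UNIV. q i * P $ i | q. True}"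

definition graded_local_order :: "('n::finite monom \<Rightarrow> 'n monom \<Rightarrow> bool) \<Rightarrow> bool"
  where "graded_local_order le \<longleftrightarrow>
    reflp le \<and> transp le \<and> antisymp le \<and> totalp le \<and>
    (\<forall>a b c. le a b \<longrightarrow> le (a + c) (b + c)) \<and>
    (\<forall>a b. mdeg a > mdeg b \<longrightarrow> le a b \<and> a \<noteq> b)"

definition is_initial_monom :: "('n monom \<Rightarrow> 'n monom \<Rightarrow> bool) \<Rightarrow> 'n mpoly \<Rightarrow> 'n monom \<Rightarrow> bool"
  where "is_initial_monom le p m \<longleftrightarrow> m \<in> Poly_Mapping.keys p \<and>
    (\<forall>m'\<in>Poly_Mapping.keys p. le m' m)"

definition standard_monoms :: "('n monom \<Rightarrow> 'n monom \<Rightarrow> bool) \<Rightarrow> 'n mpoly set \<Rightarrow> 'n monom set"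
  where "standard_monoms le I = {m. \<not> (\<exists>p\<in>I. is_initial_monom le p m)}"

definition hilbert_series :: "('n::finite monom \<Rightarrow> 'n monom \<Rightarrow> bool) \<Rightarrow> 'n mpoly set \<Rightarrow> int fps"
  where "hilbert_series le I = Abs_fps (\<lambda>k. int (card {m \<in> standard_monoms le I. mdeg m = k}))"

definition regular_zero_at_origin ::
    "('n::finite monom \<Rightarrow> 'n monom \<Rightarrow> bool) \<Rightarrow> nat \<Rightarrow> nat \<Rightarrow> 'n system \<Rightarrow> bool"
  where "regular_zero_at_origin le \<kappa> d P \<longleftrightarrow>
    isolated_zero P 0 \<and> breadth P 0 = \<kappa> \<and>
    hilbert_series le (sys_ideal P) = (\<Sum>i<d. fps_X ^ i) ^ \<kappa>"

definition translation :: "complex^'n \<Rightarrow> 'n::finite system"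
  where "translation z = (\<chi> i. Var i + Const (z $ i))"

definition regular_zero ::
    "('n::finite monom \<Rightarrow> 'n monom \<Rightarrow> bool) \<Rightarrow> nat \<Rightarrow> nat \<Rightarrow> 'n system \<Rightarrow> complex^'n \<Rightarrow> bool"
  where "regular_zero le \<kappa> d G z \<longleftrightarrow> regular_zero_at_origin le \<kappa> d (sys_comp G (translation z))"

definition pre_inflatable :: "nat \<Rightarrow> nat \<Rightarrow> nat \<Rightarrow> 'n::{finite,linorder} system \<Rightarrow> bool"
  where "pre_inflatable \<kappa> k l P \<longleftrightarrow>
    \<kappa> \<le> CARD('n) \<and> isolated_zero P 0 \<and>
    jacobian_kernel P 0 = vec.span {axis i 1 | i. pos i < \<kappa>} \<and>
    (\<forall>i. pos i < \<kappa> \<longrightarrow>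
      (\<forall>m\<in>Poly_Mapping.keys (P $ i).
        (\<exists>j. \<kappa> \<le> pos j \<and> Poly_Mapping.lookup m j \<noteq> 0) \<longrightarrow> mdeg m > k)) \<and>
    (\<forall>i. \<kappa> \<le> pos i \<longrightarrow>
      (\<forall>m\<in>Poly_Mapping.keys (P $ i).
        (\<forall>j. \<kappa> \<le> pos j \<longrightarrow> Poly_Mapping.lookup m j = 0) \<longrightarrow> mdeg m > l))"

text \<open>Only meaningful for nonzero polynomials.\<close>
definition initial_degree :: "'n::finite mpoly \<Rightarrow> nat"
  where "initial_degree p = Min (mdeg ` Poly_Mapping.keys p)"

definition initial_form :: "'n::finite mpoly \<Rightarrow> 'n mpoly"
  where "initial_form p =
    (\<Sum>m | m \<in> Poly_Mapping.keys p \<and> mdeg m = initial_degree p.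
      Poly_Mapping.single m (Poly_Mapping.lookup p m))"

text \<open>
  Local invertibility with a differentiable local inverse. Real differentiability suffices: the
  derivative of the inverse of a polynomial map inverts a complex linear map, so the inverse is
  automatically holomorphic.
\<close>
definition locally_invertible_at :: "(complex^'n::finite \<Rightarrow> complex^'n) \<Rightarrow> complex^'n \<Rightarrow> bool"
  where "locally_invertible_at f a \<longleftrightarrow>
    (\<exists>S T g. open S \<and> open T \<and> a \<in> S \<and> homeomorphism S T f g \<and> g differentiable_on T)"

end

theory Submission
  imports Defs
begin

text \<open>
  Translations, linear maps, shears in the last \<open>n - \<kappa>\<close> variables and block unipotent matrices all have
  polynomial inverses, and composing them reaches a pre-inflatable system one degree at a time. These
  transformations preserve the number of standard monomials of degree less than \<open>k\<close>, since this is the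
  dimension of the polynomial ring modulo \<open>I + m\<^sup>k\<close>, where \<open>m\<close> is the ideal of the origin. The Hilbert series in
  degrees up to \<open>d\<close> then forces \<open>p\<^sub>1, \<dots>, p\<^sub>\<kappa>\<close> to have order exactly \<open>d\<close>.

  A common zero of their initial forms is excluded by counting monomials. After a linear change of
  variables it is the first unit vector. Give \<open>x\<^sub>1, \<dots>, x\<^sub>\<kappa>\<close> the weight 1 and the other variables the weight
  \<open>d\<close>: all \<open>p\<^sub>i\<close> have weight at least \<open>d\<close>. Give \<open>x\<^sub>1\<close> the weight 1, \<open>x\<^sub>2, \<dots>, x\<^sub>\<kappa>\<close> the weight 2 and the others
  the weight \<open>d + 1\<close>: all \<open>p\<^sub>i\<close> have weight at least \<open>d + 1\<close>, because \<open>x\<^sub>1\<close> to the power \<open>d\<close> does not occur. So a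
  monomial of first weight less than \<open>s d\<close> or second weight less than \<open>s (d + 1)\<close> occurs in no element of the
  \<open>s\<close>-th power of the ideal. For large \<open>s\<close> there are more such monomials than the local colength of that
  power allows, which is at most the colength \<open>d\<^sup>\<kappa>\<close> of the ideal times the number of monomials of degree
  less than \<open>s\<close>.
\<close>

section \<open>Substitution and evaluation of polynomials\<close>

abbreviation "lookup \<equiv> Poly_Mapping.lookup"
abbreviation "keys \<equiv> Poly_Mapping.keys"
abbreviation "single \<equiv> Poly_Mapping.single"

lemma poly_mapping_sum_singles: "(\<Sum>m\<in>keys p. single m (lookup p m)) = p"
  by (rule poly_mapping_eqI)
    (auto simp: lookup_sum lookup_single when_def not_in_keys_iff_lookup_eq_zero sum.delta)

text \<open>The zero polynomial falls under the first case as \<open>single m 0\<close>, so a sum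
  over a finite set of monomials needs no further base case.\<close>

lemma mpoly_induct [case_names single add]:
  fixes p :: "'a \<Rightarrow>\<^sub>0 'b::comm_monoid_add"
  assumes "\<And>m a. P (single m a)" "\<And>p q. P p \<Longrightarrow> P q \<Longrightarrow> P (p + q)"
  shows "P p"
proof -
  have "P (\<Sum>m\<in>A. single m (lookup p m))" if "finite A" for A
    using that
  proof (induction A rule: finite_induct)
    case empty
    show ?case using assms(1)[of undefined 0] by simp
  qed (simp add: assms)
  then show ?thesis
    using poly_mapping_sum_singles[of p] by (metis finite_keys)
qed

text \<open>The common form of \<open>psubst\<close> and \<open>peval\<close>: coefficients are
  mapped by \<open>c\<close> and variables by \<open>f\<close>. The homomorphism laws are proved
  here once and then specialized to both.\<close>

definition mhom :: "(complex \<Rightarrow> 'b::comm_ring_1) \<Rightarrow> ('n::finite \<Rightarrow> 'b) \<Rightarrow> 'n mpoly \<Rightarrow> 'b"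
  where "mhom c f p = (\<Sum>m\<in>keys p. c (lookup p m) * (\<Prod>i\<in>UNIV. f i ^ lookup m i))"

locale coeff_hom =
  fixes c :: "complex \<Rightarrow> 'b::comm_ring_1"
  assumes c_0: "c 0 = 0" and c_1: "c 1 = 1"
    and c_add: "c (a + b) = c a + c b" and c_mult: "c (a * b) = c a * c b"
begin

lemma mhom_superset:
  assumes "finite S" "keys p \<subseteq> S"
  shows "mhom c f p = (\<Sum>m\<in>S. c (lookup p m) * (\<Prod>i\<in>UNIV. f i ^ lookup m i))"
  unfolding mhom_def using assms
  by (intro sum.mono_neutral_left) (auto simp: not_in_keys_iff_lookup_eq_zero c_0)

lemma mhom_single: "mhom c f (single m a) = c a * (\<Prod>i\<in>UNIV. f i ^ lookup m i)"
  by (subst mhom_superset[where S = "{m}"]) auto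

lemma mhom_0: "mhom c f 0 = 0"
  by (simp add: mhom_def)

lemma mhom_add: "mhom c f (p + q) = mhom c f p + mhom c f q"
proof -
  let ?S = "keys p \<union> keys q"
  have "keys (p + q) \<subseteq> ?S" by (rule Poly_Mapping.keys_add)
  then show ?thesis
    by (simp add: mhom_superset[where S = ?S] lookup_add c_add ring_distribs sum.distrib)
qed

lemma mhom_mult: "mhom c f (p * q) = mhom c f p * mhom c f q"
proof (induction p rule: mpoly_induct)
  case (single m a)
  show ?case
  proof (induction q rule: mpoly_induct)
    case (single m' a')
    show ?case
      by (simp add: mult_single mhom_single c_mult lookup_add power_add prod.distrib)
  qed (simp add: mhom_add ring_distribs)
qed (simp add: mhom_add ring_distribs)

end

lemma Const_0 [simp]: "Const 0 = 0"
  and Const_1 [simp]: "Const 1 = 1"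
  and Const_add: "Const (a + b) = Const a + Const b"
  and Const_mult: "Const (a * b) = Const a * Const b"
  and Const_uminus: "Const (- a) = - Const a"
  by (simp_all add: Const_def single_add mult_single single_uminus)

lemma Const_sum: "Const (sum f A) = (\<Sum>a\<in>A. Const (f a))"
  by (induction A rule: infinite_finite_induct) (simp_all add: Const_add)

lemma Const_prod: "Const (prod f A) = (\<Prod>a\<in>A. Const (f a))"
  by (induction A rule: infinite_finite_induct) (simp_all add: Const_mult)

lemma Const_power: "Const (a ^ k) = Const a ^ k"
  by (induction k) (simp_all add: Const_mult)

interpretation Const: coeff_hom Const
  by unfold_locales (simp_all add: Const_add Const_mult)

interpretation cid: coeff_hom "\<lambda>a. a"
  by unfold_locales simp_all

lemma psubst_mhom: "psubst p \<Phi> = mhom Const (($) \<Phi>) p"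
  by (simp add: psubst_def mhom_def)

lemma peval_mhom: "peval p x = mhom (\<lambda>a. a) (($) x) p"
  by (simp add: peval_def mhom_def)

lemma psubst_single: "psubst (single m a) \<Phi> = Const a * (\<Prod>i\<in>UNIV. (\<Phi> $ i) ^ lookup m i)"
  by (simp add: psubst_mhom Const.mhom_single)

lemma peval_single: "peval (single m a) x = a * (\<Prod>i\<in>UNIV. (x $ i) ^ lookup m i)"
  by (simp add: peval_mhom cid.mhom_single)

lemma psubst_0 [simp]: "psubst 0 \<Phi> = 0"
  and psubst_add: "psubst (p + q) \<Phi> = psubst p \<Phi> + psubst q \<Phi>"
  and psubst_mult: "psubst (p * q) \<Phi> = psubst p \<Phi> * psubst q \<Phi>"
  by (simp_all add: psubst_mhom Const.mhom_0 Const.mhom_add Const.mhom_mult)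

lemma peval_0 [simp]: "peval 0 x = 0"
  and peval_add: "peval (p + q) x = peval p x + peval q x"
  and peval_mult: "peval (p * q) x = peval p x * peval q x"
  by (simp_all add: peval_mhom cid.mhom_0 cid.mhom_add cid.mhom_mult)

lemma psubst_Const [simp]: "psubst (Const a) \<Phi> = Const a"
  by (subst Const_def) (simp add: psubst_single)

lemma peval_Const [simp]: "peval (Const a) x = a"
  by (subst Const_def) (simp add: peval_single)

lemma psubst_1 [simp]: "psubst 1 \<Phi> = 1"
  using psubst_Const[of 1] by simp

lemma peval_1 [simp]: "peval 1 x = 1"
  using peval_Const[of 1] by simp

lemma prod_power_single: "(\<Prod>i\<in>UNIV. f i ^ lookup (single (j::'n::finite) k) i) = (f j ^ k :: 'a::comm_monoid_mult)"
proof -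
  have "(\<Prod>i\<in>UNIV. f i ^ lookup (single j k) i) = (\<Prod>i\<in>UNIV. if i = j then f i ^ k else 1)"
    by (intro prod.cong) (auto simp: lookup_single when_def)
  also have "\<dots> = f j ^ k"
    by simp
  finally show ?thesis .
qed

lemma psubst_Var [simp]: "psubst (Var i) \<Phi> = \<Phi> $ i"
  unfolding Var_def psubst_single by (simp add: prod_power_single)

lemma peval_Var [simp]: "peval (Var i) x = x $ i"
  unfolding Var_def peval_single by (simp add: prod_power_single)

lemma psubst_uminus: "psubst (- p) \<Phi> = - psubst p \<Phi>"
  using psubst_add[of p "- p" \<Phi>] by (simp add: eq_neg_iff_add_eq_0 add.commute)

lemma peval_uminus: "peval (- p) x = - peval p x"
  using peval_add[of p "- p" x] by (simp add: eq_neg_iff_add_eq_0 add.commute)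

lemma psubst_diff: "psubst (p - q) \<Phi> = psubst p \<Phi> - psubst q \<Phi>"
  using psubst_add[of p "- q"] by (simp add: psubst_uminus)

lemma peval_diff: "peval (p - q) x = peval p x - peval q x"
  using peval_add[of p "- q"] by (simp add: peval_uminus)

lemma psubst_sum: "psubst (sum f A) \<Phi> = (\<Sum>a\<in>A. psubst (f a) \<Phi>)"
  by (induction A rule: infinite_finite_induct) (simp_all add: psubst_add)

lemma peval_sum: "peval (sum f A) x = (\<Sum>a\<in>A. peval (f a) x)"
  by (induction A rule: infinite_finite_induct) (simp_all add: peval_add)

lemma psubst_prod: "psubst (prod f A) \<Phi> = (\<Prod>a\<in>A. psubst (f a) \<Phi>)"
  by (induction A rule: infinite_finite_induct) (simp_all add: psubst_mult)

lemma peval_prod: "peval (prod f A) x = (\<Prod>a\<in>A. peval (f a) x)"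
  by (induction A rule: infinite_finite_induct) (simp_all add: peval_mult)

lemma psubst_power: "psubst (p ^ k) \<Phi> = psubst p \<Phi> ^ k"
  by (induction k) (simp_all add: psubst_mult)

lemma peval_power: "peval (p ^ k) x = peval p x ^ k"
  by (induction k) (simp_all add: peval_mult)

lemmas psubst_simps = psubst_add psubst_mult psubst_uminus psubst_diff psubst_sum psubst_prod psubst_power
lemmas peval_simps = peval_add peval_mult peval_uminus peval_diff peval_sum peval_prod peval_power

lemma Var_power: "Var i ^ k = single (single i k) 1"
  by (induction k) (auto simp: Var_def mult_single single_add[symmetric])

lemma prod_single:
  fixes f :: "'a \<Rightarrow> 'b::comm_monoid_add"
  assumes "finite A"
  shows "(\<Prod>i\<in>A. single (f i) (1::'c::comm_semiring_1)) = single (\<Sum>i\<in>A. f i) 1"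
  using assms by (induction A rule: finite_induct) (auto simp: mult_single)

lemma single_eq_prod_Var:
  "single m a = Const a * (\<Prod>i\<in>UNIV. Var (i::'n::finite) ^ lookup m i)"
proof -
  have "(\<Sum>i\<in>UNIV. single i (lookup m i)) = m"
    by (rule poly_mapping_eqI) (simp add: lookup_sum lookup_single when_def)
  then show ?thesis
    by (simp add: Var_power prod_single Const_def mult_single)
qed

definition sys_id :: "'n::finite system" where "sys_id = (\<chi> i. Var i)"

lemma psubst_id [simp]: "psubst p sys_id = p"
proof (induction p rule: mpoly_induct)
  case (single m a)
  then show ?case by (simp add: single_eq_prod_Var psubst_simps sys_id_def)
qed (simp add: psubst_add)

lemma sys_comp_nth [simp]: "sys_comp P \<Phi> $ i = psubst (P $ i) \<Phi>"
  by (simp add: sys_comp_def)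

lemma sys_eval_nth [simp]: "sys_eval P x $ i = peval (P $ i) x"
  by (simp add: sys_eval_def)

lemma psubst_psubst: "psubst (psubst p \<Phi>) \<Psi> = psubst p (sys_comp \<Phi> \<Psi>)"
proof (induction p rule: mpoly_induct)
  case (single m a)
  then show ?case by (simp add: psubst_single psubst_simps)
qed (simp add: psubst_add)

lemma peval_psubst: "peval (psubst p \<Phi>) x = peval p (sys_eval \<Phi> x)"
proof (induction p rule: mpoly_induct)
  case (single m a)
  then show ?case by (simp add: psubst_single peval_simps peval_single)
qed (simp add: psubst_add peval_add)

lemma sys_comp_assoc: "sys_comp (sys_comp P \<Phi>) \<Psi> = sys_comp P (sys_comp \<Phi> \<Psi>)"
  by (simp add: vec_eq_iff psubst_psubst)

lemma sys_comp_id [simp]: "sys_comp P sys_id = P"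
  by (simp add: vec_eq_iff)

lemma sys_id_comp [simp]: "sys_comp sys_id P = P"
  by (simp add: vec_eq_iff sys_id_def)

lemma sys_eval_comp: "sys_eval (sys_comp P \<Phi>) x = sys_eval P (sys_eval \<Phi> x)"
  by (simp add: vec_eq_iff peval_psubst)

lemma sys_eval_id [simp]: "sys_eval sys_id x = x"
  by (simp add: vec_eq_iff sys_id_def)

section \<open>Polynomial matrices and equivalence of systems\<close>

definition mat_comp :: "'n::finite pmatrix \<Rightarrow> 'n system \<Rightarrow> 'n pmatrix"
  where "mat_comp U \<Phi> = (\<chi> i j. psubst (U $ i $ j) \<Phi>)"

lemma mat_comp_mult: "mat_comp (U ** V) \<Phi> = mat_comp U \<Phi> ** mat_comp V \<Phi>"
  by (simp add: vec_eq_iff mat_comp_def matrix_matrix_mult_def psubst_simps)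

lemma mat_comp_1: "mat_comp (mat 1) \<Phi> = mat 1"
  by (simp add: vec_eq_iff mat_comp_def mat_def)

lemma sys_comp_matrix_vector: "sys_comp (U *v P) \<Phi> = mat_comp U \<Phi> *v sys_comp P \<Phi>"
  by (simp add: vec_eq_iff mat_comp_def matrix_vector_mult_def psubst_simps)

lemma mat_eval_mult: "mat_eval (U ** V) x = mat_eval U x ** mat_eval V x"
  by (simp add: vec_eq_iff mat_eval_def matrix_matrix_mult_def peval_simps)

lemma mat_eval_1: "mat_eval (mat 1) x = mat 1"
  by (simp add: vec_eq_iff mat_eval_def mat_def)

lemma sys_eval_matrix_vector: "sys_eval (U *v P) x = mat_eval U x *v sys_eval P x"
  by (simp add: vec_eq_iff mat_eval_def matrix_vector_mult_def peval_simps)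

text \<open>The inverses are required to be polynomial, so that no localization at the origin is needed.\<close>
definition equivalent_at :: "complex^'n::finite \<Rightarrow> 'n system \<Rightarrow> 'n system \<Rightarrow>
    'n system \<Rightarrow> 'n system \<Rightarrow> 'n pmatrix \<Rightarrow> 'n pmatrix \<Rightarrow> bool"
  where "equivalent_at z G P \<Phi> \<Psi> U V \<longleftrightarrow>
    sys_comp \<Phi> \<Psi> = sys_id \<and> sys_comp \<Psi> \<Phi> = sys_id \<and> U ** V = mat 1 \<and> V ** U = mat 1 \<and>
    sys_eval \<Phi> 0 = z \<and> P = U *v sys_comp G \<Phi>"

text \<open>From \<open>P = U *v sys_comp G \<Phi>\<close> the second step gives
  \<open>U' *v sys_comp P \<Phi>'\<close>, and the substitution \<open>\<Phi>'\<close> acts on the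
  entries of \<open>U\<close> too. This is why the composed matrix contains
  \<open>mat_comp U \<Phi>'\<close>.\<close>

lemma equivalent_at_trans:
  assumes "equivalent_at z G P \<Phi> \<Psi> U V" "equivalent_at 0 P Q \<Phi>' \<Psi>' U' V'"
  shows "equivalent_at z G Q (sys_comp \<Phi> \<Phi>') (sys_comp \<Psi>' \<Psi>)
    (U' ** mat_comp U \<Phi>') (mat_comp V \<Phi>' ** V')"
proof -
  have *: "sys_comp \<Phi> \<Psi> = sys_id" "sys_comp \<Psi> \<Phi> = sys_id" "U ** V = mat 1" "V ** U = mat 1"
    "sys_eval \<Phi> 0 = z" "P = U *v sys_comp G \<Phi>"
    "sys_comp \<Phi>' \<Psi>' = sys_id" "sys_comp \<Psi>' \<Phi>' = sys_id" "U' ** V' = mat 1" "V' ** U' = mat 1"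
    "sys_eval \<Phi>' 0 = 0" "Q = U' *v sys_comp P \<Phi>'"
    using assms by (auto simp: equivalent_at_def)
  have UV: "mat_comp U \<Phi>' ** mat_comp V \<Phi>' = mat 1" "mat_comp V \<Phi>' ** mat_comp U \<Phi>' = mat 1"
    using * by (simp_all flip: mat_comp_mult add: mat_comp_1)
  have 1: "sys_comp (sys_comp \<Phi> \<Phi>') (sys_comp \<Psi>' \<Psi>) = sys_id"
    by (metis *(1,7) sys_comp_assoc sys_id_comp)
  have 2: "sys_comp (sys_comp \<Psi>' \<Psi>) (sys_comp \<Phi> \<Phi>') = sys_id"
    by (metis *(2,8) sys_comp_assoc sys_id_comp)
  have 3: "(U' ** mat_comp U \<Phi>') ** (mat_comp V \<Phi>' ** V') = mat 1"
    by (metis UV(1) *(9) matrix_mul_assoc matrix_mul_lid)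
  have 4: "(mat_comp V \<Phi>' ** V') ** (U' ** mat_comp U \<Phi>') = mat 1"
    by (metis UV(2) *(10) matrix_mul_assoc matrix_mul_lid)
  show ?thesis unfolding equivalent_at_def
    using 1 2 3 4 * by (simp add: sys_eval_comp sys_comp_matrix_vector matrix_vector_mul_assoc sys_comp_assoc)
qed

section \<open>Weights and standard monomials\<close>

definition wdeg :: "('n::finite \<Rightarrow> nat) \<Rightarrow> 'n monom \<Rightarrow> nat"
  where "wdeg w m = (\<Sum>i\<in>UNIV. w i * lookup m i)"

definition weighted :: "('n::finite \<Rightarrow> nat) \<Rightarrow> nat \<Rightarrow> 'n mpoly set"
  where "weighted w N = {p. \<forall>m\<in>keys p. N \<le> wdeg w m}"

text \<open>\<open>order_ge k\<close> is the \<open>k\<close>-th power of the maximal ideal of the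
  origin.\<close>

abbreviation "order_ge \<equiv> weighted (\<lambda>_. Suc 0)"

lemma mdeg_wdeg: "mdeg m = wdeg (\<lambda>_. Suc 0) m"
  by (simp add: mdeg_def wdeg_def)

lemma wdeg_0 [simp]: "wdeg w 0 = 0"
  by (simp add: wdeg_def)

lemma wdeg_add: "wdeg w (m + m') = wdeg w m + wdeg w m'"
  by (simp add: wdeg_def lookup_add ring_distribs sum.distrib)

lemma wdeg_single [simp]: "wdeg w (single i k) = w i * k"
  by (simp add: wdeg_def lookup_single when_def if_distrib[of "(*) _"] cong: if_cong)

lemma mdeg_0 [simp]: "mdeg 0 = 0"
  and mdeg_add: "mdeg (m + m') = mdeg m + mdeg m'"
  and mdeg_single [simp]: "mdeg (single i k) = k"
  by (simp_all add: mdeg_wdeg wdeg_add)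

lemma weighted_iff: "p \<in> weighted w N \<longleftrightarrow> (\<forall>m. wdeg w m < N \<longrightarrow> lookup p m = 0)"
  by (auto simp: weighted_def in_keys_iff not_le[symmetric])

lemma weighted_0 [simp]: "0 \<in> weighted w N"
  by (simp add: weighted_def)

lemma weighted_zero [simp]: "weighted w 0 = UNIV"
  by (simp add: weighted_def)

lemma weighted_add: "p \<in> weighted w N \<Longrightarrow> q \<in> weighted w N \<Longrightarrow> p + q \<in> weighted w N"
  by (simp add: weighted_iff lookup_add)

lemma weighted_diff: "p \<in> weighted w N \<Longrightarrow> q \<in> weighted w N \<Longrightarrow> p - q \<in> weighted w N"
  by (simp add: weighted_iff lookup_minus)

lemma weighted_sum: "(\<And>a. a \<in> A \<Longrightarrow> f a \<in> weighted w N) \<Longrightarrow> sum f A \<in> weighted w N"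
  by (induction A rule: infinite_finite_induct) (auto intro: weighted_add)

lemma weighted_mono: "p \<in> weighted w N \<Longrightarrow> N' \<le> N \<Longrightarrow> p \<in> weighted w N'"
  by (auto simp: weighted_def)

lemma weighted_mult:
  assumes "p \<in> weighted w N" "q \<in> weighted w N'"
  shows "p * q \<in> weighted w (N + N')"
  unfolding weighted_def
proof safe
  fix m assume "m \<in> keys (p * q)"
  then obtain a b where "a \<in> keys p" "b \<in> keys q" "m = a + b"
    using keys_mult[of p q] by blast
  then show "N + N' \<le> wdeg w m"
    using assms by (auto simp: weighted_def wdeg_add intro: add_mono)
qed

lemma weighted_mult_left: "q \<in> weighted w N \<Longrightarrow> p * q \<in> weighted w N"
  using weighted_mult[of p w 0 q N] by simp

lemma weighted_single: "a \<noteq> 0 \<longrightarrow> N \<le> wdeg w m \<Longrightarrow> single m a \<in> weighted w N"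
  by (simp add: weighted_def)

lemma weighted_Var: "Var i \<in> weighted w (w i)"
  by (simp add: Var_def weighted_single)

lemma weighted_power: "p \<in> weighted w N \<Longrightarrow> p ^ k \<in> weighted w (N * k)"
  by (induction k) (auto dest: weighted_mult)

lemma weighted_prod:
  "finite A \<Longrightarrow> (\<And>i. i \<in> A \<Longrightarrow> f i \<in> weighted w (u i)) \<Longrightarrow> prod f A \<in> weighted w (sum u A)"
  by (induction A rule: finite_induct) (auto intro: weighted_mult)

lemma weighted_prod_power:
  assumes "\<And>i. f i \<in> weighted w (u i)"
  shows "(\<Prod>i\<in>UNIV. f i ^ lookup m i) \<in> weighted w (wdeg u m)"
  unfolding wdeg_def by (intro weighted_prod weighted_power assms) auto

text \<open>Each variable of source weight \<open>u i\<close> is replaced by a polynomial of target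
  weight at least \<open>u i\<close>, so no term loses weight. Choosing \<open>u\<close> and
  \<open>w\<close> differently tracks how a coordinate change mixes the two groups of
  variables.\<close>

lemma psubst_weighted:
  assumes "\<And>i. \<Phi> $ i \<in> weighted w (u i)" "p \<in> weighted u N"
  shows "psubst p \<Phi> \<in> weighted w N"
  unfolding psubst_def
proof (intro weighted_sum weighted_mult_left)
  fix m assume "m \<in> keys p"
  then have "N \<le> wdeg u m" using assms(2) by (auto simp: weighted_def)
  then show "(\<Prod>i\<in>UNIV. (\<Phi> $ i) ^ lookup m i) \<in> weighted w N"
    using weighted_mono weighted_prod_power[of "($) \<Phi>" w u m] assms(1) by blast
qed

lemma lookup_Const_mult [simp]: "lookup (Const a * p) m = a * lookup p m"
proof -
  have "Const a * p = Poly_Mapping.map ((*) a) p"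
    by (simp add: Const_def mult_map_scale_conv_mult)
  then show ?thesis by (simp add: Poly_Mapping.map.rep_eq when_def)
qed

lemma lookup_Const: "lookup (Const a) m = (a when m = 0)"
  by (auto simp: Const_def lookup_single when_def)

lemma Const_mult_single [simp]: "Const a * single m b = single m (a * b)"
  by (simp add: Const_def mult_single)

section \<open>Polynomials as a vector space and linear relations\<close>

interpretation mp: vector_space "\<lambda>a p. Const a * (p :: 'n mpoly)"
  by unfold_locales (simp_all add: ring_distribs Const_add Const_mult mult.assoc)

lemma subspace_weighted: "mp.subspace (weighted w N)"
  by (auto simp: mp.subspace_def intro: weighted_add weighted_mult_left)

text \<open>Stated for a family \<open>q\<close> instead of a set: if \<open>q\<close> takes a value
  twice, the difference of the two members is already a relation; otherwise the image has more
  elements than an independent subset of the span can have.\<close>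

lemma (in vector_space) exists_relation:
  assumes "finite S" "finite B" "card B < card S" "q ` S \<subseteq> span B"
  obtains c where "\<exists>x\<in>S. c x \<noteq> 0" "(\<Sum>x\<in>S. scale (c x) (q x)) = 0"
proof (cases "inj_on q S")
  case True
  have "card (q ` S) = card S" by (simp add: True card_image)
  then have "dependent (q ` S)"
    using independent_span_bound[of B "q ` S"] assms by auto
  then obtain u where u: "\<exists>v\<in>q ` S. u v \<noteq> 0" "(\<Sum>v\<in>q ` S. scale (u v) v) = 0"
    using dependent_finite[of "q ` S"] assms(1) by auto
  show thesis
    by (rule that[of "u \<circ> q"]) (use u True in \<open>auto simp: sum.reindex\<close>)
next
  case False
  then obtain x y where xy: "x \<in> S" "y \<in> S" "x \<noteq> y" "q x = q y"
    by (auto simp: inj_on_def)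
  define c where "c = (\<lambda>z. if z = x then 1 else if z = y then - 1 else (0 :: 'a))"
  have "(\<Sum>z\<in>S. scale (c z) (q z)) = (\<Sum>z\<in>{x, y}. scale (c z) (q z))"
    by (rule sum.mono_neutral_right) (use assms(1) xy in \<open>auto simp: c_def\<close>)
  also have "\<dots> = 0"
    using xy by (simp add: c_def)
  finally have "(\<Sum>z\<in>S. scale (c z) (q z)) = 0" .
  moreover have "\<exists>z\<in>S. c z \<noteq> 0"
    using xy by (intro bexI[of _ x]) (simp_all add: c_def)
  ultimately show thesis
    using that by blast
qed

text \<open>Pigeonhole principle in the quotient by \<open>Z\<close>: the classes of the
  \<open>f \<alpha>\<close> lie in the span of the classes of \<open>B\<close>, and there are more
  of them than \<open>B\<close> has elements.\<close>

lemma exists_combination_in_subspace: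
  assumes "finite A" "finite B" "card B < card A" "mp.subspace Z"
    and "\<And>\<alpha>. \<alpha> \<in> A \<Longrightarrow> \<exists>q\<in>mp.span B. f \<alpha> - q \<in> Z"
  shows "\<exists>c. (\<exists>\<alpha>\<in>A. c \<alpha> \<noteq> 0) \<and> (\<Sum>\<alpha>\<in>A. Const (c \<alpha>) * f \<alpha>) \<in> Z"
proof -
  obtain q where q: "q \<alpha> \<in> mp.span B" "f \<alpha> - q \<alpha> \<in> Z" if "\<alpha> \<in> A" for \<alpha>
    using assms(5) by metis
  have "q ` A \<subseteq> mp.span B" using q by auto
  then obtain c where c: "\<exists>\<alpha>\<in>A. c \<alpha> \<noteq> 0" "(\<Sum>\<alpha>\<in>A. Const (c \<alpha>) * q \<alpha>) = 0"
    using mp.exists_relation[OF assms(1-3)] by blast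
  have "(\<Sum>\<alpha>\<in>A. Const (c \<alpha>) * f \<alpha>) = (\<Sum>\<alpha>\<in>A. Const (c \<alpha>) * (f \<alpha> - q \<alpha>))"
    using c(2) by (simp add: right_diff_distrib sum_subtractf)
  also have "\<dots> \<in> Z"
    by (intro mp.subspace_sum[OF assms(4)] mp.subspace_scale[OF assms(4)] q)
  finally show ?thesis
    using c(1) by blast
qed

lemma lookup_sum_single_family:
  "finite A \<Longrightarrow> lookup (\<Sum>\<alpha>\<in>A. Const (c \<alpha>) * single \<alpha> 1) m = (if m \<in> A then c m else 0)"
  by (simp add: lookup_sum lookup_single when_def)

lemma finite_mdeg_less [simp]: "finite {m :: 'n::finite monom. mdeg m < k}"
proof (rule finite_imageD)
  have le: "lookup m i \<le> mdeg m" for m :: "'n monom" and i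
    unfolding mdeg_def by (rule member_le_sum) auto
  have "lookup ` {m :: 'n monom. mdeg m < k} \<subseteq> UNIV \<rightarrow>\<^sub>E {..<k}"
    using le by (auto simp: PiE_def Pi_def) (meson le_less_trans)
  then show "finite (lookup ` {m :: 'n monom. mdeg m < k})"
    by (rule finite_subset) (intro finite_PiE; simp)
  show "inj_on lookup {m :: 'n monom. mdeg m < k}"
    by (auto intro!: inj_onI poly_mapping_eqI)
qed

section \<open>Standard monomials as a basis of a truncated quotient\<close>

definition std_below :: "('n::finite monom \<Rightarrow> 'n monom \<Rightarrow> bool) \<Rightarrow> 'n mpoly set \<Rightarrow> nat \<Rightarrow> 'n monom set"
  where "std_below le I k = {m \<in> standard_monoms le I. mdeg m < k}"

lemma finite_std_below [simp]: "finite (std_below le I k)"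
  by (rule finite_subset[OF _ finite_mdeg_less[of k]]) (auto simp: std_below_def)

text \<open>\<open>B\<close> spans the polynomial ring modulo \<open>I\<close> plus the
  \<open>k\<close>-th power of the maximal ideal of the origin.\<close>

definition spans_mod :: "'n::finite mpoly set \<Rightarrow> 'n mpoly set \<Rightarrow> nat \<Rightarrow> bool"
  where "spans_mod B I k \<longleftrightarrow> (\<forall>p. \<exists>q\<in>mp.span B. \<exists>r\<in>I. p - q - r \<in> order_ge k)"

lemma subspace_sys_ideal: "mp.subspace (sys_ideal P)"
  unfolding mp.subspace_def sys_ideal_def
proof safe
  show "\<exists>q. 0 = (\<Sum>i\<in>UNIV. q i * P $ i) \<and> True"
    by (intro exI[of _ "\<lambda>_. 0"]) simp
next
  fix q q'
  show "\<exists>s. (\<Sum>i\<in>UNIV. q i * P $ i) + (\<Sum>i\<in>UNIV. q' i * P $ i) = (\<Sum>i\<in>UNIV. s i * P $ i) \<and> True"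
    by (intro exI[of _ "\<lambda>i. q i + q' i"]) (simp add: ring_distribs sum.distrib)
next
  fix a q
  show "\<exists>s. Const a * (\<Sum>i\<in>UNIV. q i * P $ i) = (\<Sum>i\<in>UNIV. s i * P $ i) \<and> True"
    by (intro exI[of _ "\<lambda>i. Const a * q i"]) (simp add: sum_distrib_left mult.assoc)
qed

lemma sys_ideal_mult: "r \<in> sys_ideal P \<Longrightarrow> p * r \<in> sys_ideal P"
  unfolding sys_ideal_def
proof clarify
  fix q
  show "\<exists>s. p * (\<Sum>i\<in>UNIV. q i * P $ i) = (\<Sum>i\<in>UNIV. s i * P $ i) \<and> True"
    by (intro exI[of _ "\<lambda>i. p * q i"]) (simp add: sum_distrib_left mult.assoc)
qed

lemma sys_ideal_gen: "P $ i \<in> sys_ideal P"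
proof -
  have "P $ i = (\<Sum>j\<in>UNIV. (if j = i then 1 else 0) * P $ j)"
    by (simp add: if_distrib[of "\<lambda>x. x * _"] cong: if_cong)
  then show ?thesis by (auto simp: sys_ideal_def)
qed

locale monomial_order =
  fixes le :: "'n::finite monom \<Rightarrow> 'n monom \<Rightarrow> bool"
  assumes glo: "graded_local_order le"
begin

lemma le_refl [simp]: "le a a"
  using glo by (auto simp: graded_local_order_def dest: reflpD)

lemma le_antisym: "le a b \<Longrightarrow> le b a \<Longrightarrow> a = b"
  using glo by (auto simp: graded_local_order_def dest: antisympD)

lemma le_trans: "le a b \<Longrightarrow> le b c \<Longrightarrow> le a c"
  using glo by (auto simp: graded_local_order_def dest: transpD)

lemma le_total: "le a b \<or> le b a"
  using glo by (metis graded_local_order_def le_refl totalpD)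

lemma le_add: "le a b \<Longrightarrow> le (a + c) (b + c)"
  using glo by (auto simp: graded_local_order_def)

lemma le_mdeg: "mdeg b < mdeg a \<Longrightarrow> le a b"
  using glo by (auto simp: graded_local_order_def)

lemma mdeg_antimono: "le a b \<Longrightarrow> mdeg b \<le> mdeg a"
  using glo le_antisym by (metis graded_local_order_def not_le)

lemma finite_has_greatest:
  assumes "finite A" "A \<noteq> {}"
  shows "\<exists>m\<in>A. \<forall>a\<in>A. le a m"
  using assms
proof (induction A rule: finite_ne_induct)
    case (insert x F)
    then obtain m where m: "m \<in> F" "\<forall>a\<in>F. le a m" by blast
    show ?case
    proof (cases "le x m")
      case False
      then have "le m x" using le_total by blast
      then show ?thesis using m by (auto intro: le_trans)
    qed (use m in auto)
qed auto

lemma finite_has_least: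
  assumes "finite A" "A \<noteq> {}"
  shows "\<exists>m\<in>A. \<forall>a\<in>A. le m a"
  using assms
proof (induction A rule: finite_ne_induct)
    case (insert x F)
    then obtain m where m: "m \<in> F" "\<forall>a\<in>F. le m a" by blast
    show ?case
    proof (cases "le m x")
      case False
      then have "le x m" using le_total by blast
      then show ?thesis using m by (auto intro: le_trans)
    qed (use m in auto)
qed auto

lemma exists_initial_monom:
  assumes "p \<noteq> 0"
  obtains m where "is_initial_monom le p m"
proof -
  have "keys p \<noteq> {}" using assms poly_mapping_sum_singles[of p] by auto
  then show thesis
    using finite_has_greatest[OF finite_keys] that unfolding is_initial_monom_def by blast
qed

text \<open>A local order has infinite descending chains, but only finitely many monomials have
  degree less than \<open>k\<close>, and the others vanish in the quotient. So a least monomial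
  outside the span can be taken; being nonstandard, it is the initial monomial of some element of
  \<open>I\<close>, all of whose other terms are smaller and hence in the span.\<close>

lemma std_spans:
  assumes "mp.subspace I"
  shows "spans_mod ((\<lambda>m. single m 1) ` std_below le I k) I k"
proof -
  let ?B = "(\<lambda>m. single m (1::complex)) ` std_below le I k"
  define V where "V = {p. \<exists>q\<in>mp.span ?B. \<exists>r\<in>I. p - q - r \<in> order_ge k}"
  have VI: "q + r + t \<in> V" if "q \<in> mp.span ?B" "r \<in> I" "t \<in> order_ge k" for q r t
    using that by (force simp: V_def)
  have VE: "\<exists>q\<in>mp.span ?B. \<exists>r\<in>I. \<exists>t\<in>order_ge k. p = q + r + t" if p: "p \<in> V" for p
  proof -
    obtain q r where "q \<in> mp.span ?B" "r \<in> I" "p - q - r \<in> order_ge k"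
      using p by (auto simp: V_def)
    then show ?thesis by (intro bexI[of _ q] bexI[of _ r] bexI[of _ "p - q - r"]) auto
  qed
  have sub: "mp.subspace V"
    unfolding mp.subspace_def
  proof safe
    show "0 \<in> V"
      using VI[of 0 0 0] mp.span_zero mp.subspace_0[OF assms] by auto
    fix p p' assume p: "p \<in> V" "p' \<in> V"
    obtain q r t where *: "q \<in> mp.span ?B" "r \<in> I" "t \<in> order_ge k" "p = q + r + t"
      using VE[OF p(1)] by blast
    obtain q' r' t' where **: "q' \<in> mp.span ?B" "r' \<in> I" "t' \<in> order_ge k" "p' = q' + r' + t'"
      using VE[OF p(2)] by blast
    have "(q + q') + (r + r') + (t + t') \<in> V"
      by (intro VI mp.span_add mp.subspace_add[OF assms] weighted_add * **)
    then show "p + p' \<in> V" by (simp add: * ** algebra_simps)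
  next
    fix a p assume p: "p \<in> V"
    obtain q r t where *: "q \<in> mp.span ?B" "r \<in> I" "t \<in> order_ge k" "p = q + r + t"
      using VE[OF p] by blast
    have "Const a * q + Const a * r + Const a * t \<in> V"
      by (intro VI mp.span_scale mp.subspace_scale[OF assms] weighted_mult_left *)
    then show "Const a * p \<in> V" by (simp add: * algebra_simps)
  qed
  have hi: "t \<in> V" if "t \<in> order_ge k" for t
    using VI[of 0 0 t] that mp.span_zero mp.subspace_0[OF assms] by auto
  have Isub: "r \<in> V" if "r \<in> I" for r
    using VI[of 0 r 0] that mp.span_zero by auto
  have mono: "single m 1 \<in> V" for m
  proof (rule ccontr)
    assume "single m 1 \<notin> V"
    \<comment> \<open>The truncation makes this set of counterexamples finite, which replaces
      well-foundedness of the order.\<close>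
    let ?C = "{m. single m 1 \<notin> V}"
    have "?C \<subseteq> {m. mdeg m < k}"
    proof (intro subsetI CollectI, rule ccontr)
      fix m assume "m \<in> ?C" "\<not> mdeg m < k"
      then show False using hi[of "single m 1"] by (simp add: mdeg_wdeg weighted_single)
    qed
    then have "finite ?C" by (rule finite_subset) simp
    then obtain m0 where m0: "single m0 1 \<notin> V" "\<And>a. single a 1 \<notin> V \<Longrightarrow> le m0 a"
      using finite_has_least[of ?C] \<open>single m 1 \<notin> V\<close> by blast
    have "mdeg m0 < k" using \<open>?C \<subseteq> _\<close> m0(1) by auto
    show False
    proof (cases "m0 \<in> standard_monoms le I")
      case True
      then have "single m0 1 \<in> ?B" using \<open>mdeg m0 < k\<close> by (auto simp: std_below_def)
      then show False
        using VI[OF mp.span_base mp.subspace_0[OF assms], of "single m0 1" 0] m0(1) by simp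
    next
      case False
      then obtain g where g: "g \<in> I" "is_initial_monom le g m0"
        by (auto simp: standard_monoms_def)
      have split: "g = single m0 (lookup g m0) + (\<Sum>m\<in>keys g - {m0}. single m (lookup g m))"
        using g(2) poly_mapping_sum_singles[of g]
        by (subst sum.remove[symmetric]) (auto simp: is_initial_monom_def)
      have "(\<Sum>m\<in>keys g - {m0}. single m (lookup g m)) \<in> V"
      proof (rule mp.subspace_sum[OF sub])
        fix m' assume m': "m' \<in> keys g - {m0}"
        then have "le m' m0" using g(2) by (auto simp: is_initial_monom_def)
        then have "single m' 1 \<in> V" using m0(2)[of m'] m' le_antisym by blast
        then have "Const (lookup g m') * single m' 1 \<in> V" by (rule mp.subspace_scale[OF sub])
        then show "single m' (lookup g m') \<in> V" by simp
      qed
      \<comment> \<open>Only the initial term of \<open>g\<close> is left, and dividing by its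
        coefficient puts \<open>m0\<close> into \<open>V\<close>.\<close>
      then have "g - (\<Sum>m\<in>keys g - {m0}. single m (lookup g m)) \<in> V"
        using Isub[OF g(1)] mp.subspace_diff[OF sub] by blast
      also have "g - (\<Sum>m\<in>keys g - {m0}. single m (lookup g m)) = single m0 (lookup g m0)"
        using split by (metis add_diff_cancel_right')
      finally have "Const (inverse (lookup g m0)) * single m0 (lookup g m0) \<in> V"
        by (rule mp.subspace_scale[OF sub])
      then show False using m0(1) g(2) by (auto simp: is_initial_monom_def in_keys_iff)
    qed
  qed
  have "p \<in> V" for p
  proof (induction p rule: mpoly_induct)
    case (single m a)
    show ?case using mp.subspace_scale[OF sub mono[of m], of a] by simp
  qed (rule mp.subspace_add[OF sub])
  then show ?thesis by (auto simp: spans_mod_def V_def)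
qed

text \<open>Standard monomials of degree less than \<open>k\<close> are independent in the quotient:
  a relation would give an element of \<open>I\<close> whose terms below degree \<open>k\<close> are
  all standard, and the largest of these would be its initial monomial. With
  \<open>std_spans\<close>, their number is the dimension of the quotient, which does not mention
  the order.\<close>

lemma card_std_below_le:
  assumes I: "mp.subspace I" and B: "finite B" "spans_mod B I k"
  shows "card (std_below le I k) \<le> card B"
proof (rule ccontr)
  assume "\<not> card (std_below le I k) \<le> card B"
  let ?A = "std_below le I k"
  define Z where "Z = {r + t | r t. r \<in> I \<and> t \<in> order_ge k}"
  have Z: "mp.subspace Z"
    using mp.subspace_sums[OF I subspace_weighted[of "\<lambda>_. Suc 0" k]] by (simp add: Z_def Collect_mono)
  have "\<exists>q\<in>mp.span B. single \<alpha> 1 - q \<in> Z" for \<alpha>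
  proof -
    obtain q r where "q \<in> mp.span B" "r \<in> I" "single \<alpha> 1 - q - r \<in> order_ge k"
      using B(2) unfolding spans_mod_def by blast
    then show ?thesis
      unfolding Z_def by (intro bexI[of _ q] CollectI exI[of _ r] exI[of _ "single \<alpha> 1 - q - r"]) auto
  qed
  then obtain c where c: "\<exists>\<alpha>\<in>?A. c \<alpha> \<noteq> 0" "(\<Sum>\<alpha>\<in>?A. Const (c \<alpha>) * single \<alpha> 1) \<in> Z"
    using exists_combination_in_subspace[of ?A B Z "\<lambda>\<alpha>. single \<alpha> 1"] \<open>\<not> _\<close> B(1) Z by auto
  then obtain r t where rt: "r \<in> I" "t \<in> order_ge k" "(\<Sum>\<alpha>\<in>?A. Const (c \<alpha>) * single \<alpha> 1) = r + t"
    by (auto simp: Z_def)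
  have r: "lookup r m = (if m \<in> ?A then c m else 0)" if "mdeg m < k" for m
    using rt(2) that arg_cong[OF rt(3), of "\<lambda>p. lookup p m"]
    by (subst (asm) lookup_sum_single_family) (auto simp: lookup_add weighted_iff mdeg_wdeg)
  obtain m where m: "m \<in> ?A" "c m \<noteq> 0" "\<And>a. a \<in> ?A \<Longrightarrow> c a \<noteq> 0 \<Longrightarrow> le a m"
  proof -
    have "finite {\<alpha>\<in>?A. c \<alpha> \<noteq> 0}" "{\<alpha>\<in>?A. c \<alpha> \<noteq> 0} \<noteq> {}" using c(1) by auto
    from finite_has_greatest[OF this] show thesis using that by blast
  qed
  have "mdeg m < k" using m(1) by (simp add: std_below_def)
  \<comment> \<open>The terms of \<open>r\<close> of degree at least \<open>k\<close> are unknown,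
    but in a local order they are smaller than \<open>m\<close>.\<close>
  have "is_initial_monom le r m"
    unfolding is_initial_monom_def
  proof safe
    show "m \<in> keys r" using r[OF \<open>mdeg m < k\<close>] m by (simp add: in_keys_iff)
    fix m' assume m': "m' \<in> keys r"
    show "le m' m"
    proof (cases "mdeg m' < k")
      case True
      then show ?thesis using r[OF True] m' m(3) by (auto simp: in_keys_iff split: if_splits)
    next
      case False
      then show ?thesis using \<open>mdeg m < k\<close> by (intro le_mdeg) simp
    qed
  qed
  then show False using m(1) rt(1) by (auto simp: std_below_def standard_monoms_def)
qed

end

section \<open>Invariance of the Hilbert series under equivalence\<close>

lemma spans_mod_transfer:
  assumes "spans_mod B I k" "\<And>i. \<Phi> $ i \<in> order_ge (Suc 0)" "sys_comp \<Psi> \<Phi> = sys_id"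
    and "\<And>r. r \<in> I \<Longrightarrow> psubst r \<Phi> \<in> I'"
  shows "spans_mod ((\<lambda>p. psubst p \<Phi>) ` B) I' k"
  unfolding spans_mod_def
proof
  fix p
  let ?B = "(\<lambda>p. psubst p \<Phi>) ` B"
  \<comment> \<open>The polynomial is pulled back by \<open>\<Psi>\<close>, decomposed there and
    pushed forward by \<open>\<Phi>\<close>; having no constant terms, \<open>\<Phi>\<close> does
    not lower the order of the remainder.\<close>
  obtain q r where qr: "q \<in> mp.span B" "r \<in> I" "psubst p \<Psi> - q - r \<in> order_ge k"
    using assms(1) unfolding spans_mod_def by blast
  have "mp.span B \<subseteq> {q. psubst q \<Phi> \<in> mp.span ?B}"
    by (rule mp.span_minimal)
      (auto simp: mp.subspace_def psubst_simps intro: mp.span_base mp.span_add mp.span_scale mp.span_zero)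
  then have "psubst q \<Phi> \<in> mp.span ?B" using qr(1) by blast
  moreover have "p - psubst q \<Phi> - psubst r \<Phi> \<in> order_ge k"
  proof -
    have "psubst (psubst p \<Psi> - q - r) \<Phi> \<in> order_ge k"
      by (rule psubst_weighted[OF assms(2) qr(3)])
    then show ?thesis by (simp add: psubst_diff psubst_psubst assms(3))
  qed
  ultimately show "\<exists>q\<in>mp.span ?B. \<exists>r\<in>I'. p - q - r \<in> order_ge k"
    using assms(4)[OF qr(2)] by blast
qed

lemma peval_at_0: "peval (p :: 'n::finite mpoly) 0 = lookup p 0"
proof -
  have *: "(\<Prod>i\<in>UNIV. ((0::complex^'n) $ i) ^ lookup m i) = (if m = 0 then 1 else 0)" for m :: "'n monom"
  proof (cases "m = 0")
    case False
    then obtain i where "lookup m i \<noteq> 0" by (metis poly_mapping_eqI lookup_zero)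
    then show ?thesis using False by (auto intro!: prod_zero bexI[of _ i])
  qed simp
  then have "peval p 0 = (\<Sum>m\<in>keys p. if m = 0 then lookup p m else 0)"
    unfolding peval_def by (intro sum.cong refl) (simp only: *, simp)
  then show ?thesis
    by (simp add: sum.delta in_keys_iff)
qed

lemma wdeg_one_eq_0_iff: "wdeg (\<lambda>_. Suc 0) m = 0 \<longleftrightarrow> m = 0"
  by (auto simp: wdeg_def intro: poly_mapping_eqI)

lemma order_ge_1_iff: "p \<in> order_ge (Suc 0) \<longleftrightarrow> lookup p 0 = 0"
  by (simp add: weighted_iff wdeg_one_eq_0_iff)

lemma sys_ideal_subst:
  assumes "r \<in> sys_ideal G" "\<And>i. psubst (G $ i) \<Phi> \<in> sys_ideal P"
  shows "psubst r \<Phi> \<in> sys_ideal P"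
proof -
  obtain q where "r = (\<Sum>i\<in>UNIV. q i * G $ i)" using assms(1) by (auto simp: sys_ideal_def)
  then show ?thesis
    by (auto simp: psubst_simps intro!: mp.subspace_sum[OF subspace_sys_ideal] sys_ideal_mult assms(2))
qed

lemma sys_ideal_matrix_vector: "(U *v P) $ i \<in> sys_ideal P"
  by (auto simp: matrix_vector_mult_def intro!: mp.subspace_sum[OF subspace_sys_ideal] sys_ideal_mult sys_ideal_gen)

text \<open>The inverse matrix \<open>V\<close> expresses \<open>sys_comp G \<Phi>\<close> through
  \<open>P\<close>, and \<open>mat_comp U \<Psi>\<close> expresses \<open>sys_comp P \<Psi>\<close>
  through \<open>G\<close>. Both coordinate changes fix the origin, so they have no constant
  terms.\<close>

lemma equivalent_at_0_ideal:
  assumes "equivalent_at 0 G P \<Phi> \<Psi> U V"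
  shows "r \<in> sys_ideal G \<Longrightarrow> psubst r \<Phi> \<in> sys_ideal P"
    and "r \<in> sys_ideal P \<Longrightarrow> psubst r \<Psi> \<in> sys_ideal G"
    and "\<Phi> $ i \<in> order_ge (Suc 0)" "\<Psi> $ i \<in> order_ge (Suc 0)"
proof -
  have *: "sys_comp \<Phi> \<Psi> = sys_id" "sys_comp \<Psi> \<Phi> = sys_id" "U ** V = mat 1" "V ** U = mat 1"
    "sys_eval \<Phi> 0 = 0" "P = U *v sys_comp G \<Phi>"
    using assms by (auto simp: equivalent_at_def)
  have "sys_comp G \<Phi> = V *v P" by (simp add: * matrix_vector_mul_assoc)
  then have "psubst (G $ i) \<Phi> \<in> sys_ideal P" for i
    by (metis sys_comp_nth sys_ideal_matrix_vector)
  then show "r \<in> sys_ideal G \<Longrightarrow> psubst r \<Phi> \<in> sys_ideal P"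
    by (rule sys_ideal_subst[rotated])
  have "sys_comp P \<Psi> = mat_comp U \<Psi> *v G"
    by (simp add: * sys_comp_matrix_vector sys_comp_assoc)
  then have "psubst (P $ i) \<Psi> \<in> sys_ideal G" for i
    by (metis sys_comp_nth sys_ideal_matrix_vector)
  then show "r \<in> sys_ideal P \<Longrightarrow> psubst r \<Psi> \<in> sys_ideal G"
    by (rule sys_ideal_subst[rotated])
  show "\<Phi> $ i \<in> order_ge (Suc 0)"
    using *(5) by (simp add: vec_eq_iff order_ge_1_iff peval_at_0)
  have "sys_eval \<Psi> 0 = 0"
    by (metis *(2,5) sys_eval_comp sys_eval_id)
  then show "\<Psi> $ i \<in> order_ge (Suc 0)"
    by (simp add: vec_eq_iff order_ge_1_iff peval_at_0)
qed

context monomial_order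
begin

text \<open>The images of the standard monomials of one ideal span the truncated quotient of the
  other, which gives one inequality; \<open>\<Phi>\<close> and \<open>\<Psi>\<close> exchange roles
  for the other.\<close>

lemma equivalent_at_0_card_std_below:
  assumes "equivalent_at 0 G P \<Phi> \<Psi> U V"
  shows "card (std_below le (sys_ideal P) k) = card (std_below le (sys_ideal G) k)"
proof (rule antisym)
  have *: "sys_comp \<Phi> \<Psi> = sys_id" "sys_comp \<Psi> \<Phi> = sys_id"
    using assms by (auto simp: equivalent_at_def)
  have aux: "card (std_below le (sys_ideal P) k) \<le> card (std_below le (sys_ideal G) k)"
    if "\<And>i. \<Phi> $ i \<in> order_ge (Suc 0)" "sys_comp \<Psi> \<Phi> = sys_id"
      "\<And>r. r \<in> sys_ideal G \<Longrightarrow> psubst r \<Phi> \<in> sys_ideal P" for G P \<Phi> \<Psi> :: "'n system"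
  proof -
    let ?B = "(\<lambda>m. single m 1) ` std_below le (sys_ideal G) k"
    have "card (std_below le (sys_ideal P) k) \<le> card ((\<lambda>p. psubst p \<Phi>) ` ?B)"
      by (rule card_std_below_le[OF subspace_sys_ideal _
        spans_mod_transfer[OF std_spans[OF subspace_sys_ideal] that]]) simp
    also have "\<dots> \<le> card (std_below le (sys_ideal G) k)"
      by (simp only: image_image) (rule card_image_le, simp)
    finally show ?thesis .
  qed
  show "card (std_below le (sys_ideal P) k) \<le> card (std_below le (sys_ideal G) k)"
    by (rule aux[OF _ *(2)]) (use equivalent_at_0_ideal[OF assms] in auto)
  show "card (std_below le (sys_ideal G) k) \<le> card (std_below le (sys_ideal P) k)"
    by (rule aux[OF _ *(1)]) (use equivalent_at_0_ideal[OF assms] in auto)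
qed

lemma card_std_below_Suc:
  "card (std_below le I (Suc k)) = card (std_below le I k) + card {m \<in> standard_monoms le I. mdeg m = k}"
proof -
  have "std_below le I (Suc k) = std_below le I k \<union> {m \<in> standard_monoms le I. mdeg m = k}"
    by (auto simp: std_below_def)
  moreover have "finite {m \<in> standard_monoms le I. mdeg m = k}"
    by (rule finite_subset[OF _ finite_mdeg_less[of "Suc k"]]) auto
  ultimately show ?thesis
    by (simp add: card_Un_disjoint std_below_def disjoint_iff)
qed

lemma equivalent_at_0_hilbert_series:
  assumes "equivalent_at 0 G P \<Phi> \<Psi> U V"
  shows "hilbert_series le (sys_ideal P) = hilbert_series le (sys_ideal G)"
  unfolding hilbert_series_def
proof (intro arg_cong[where f = Abs_fps] ext)
  fix k
  show "int (card {m \<in> standard_monoms le (sys_ideal P). mdeg m = k}) =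
    int (card {m \<in> standard_monoms le (sys_ideal G). mdeg m = k})"
    using card_std_below_Suc[of "sys_ideal P" k] card_std_below_Suc[of "sys_ideal G" k]
      equivalent_at_0_card_std_below[OF assms] by simp
qed

end

section \<open>Counting monomials outside powers of an ideal\<close>

text \<open>The monomial \<open>\<beta>\<close> evaluated at the generators. Those with
  \<open>mdeg \<beta> = s\<close> generate the \<open>s\<close>-th power of the ideal.\<close>

definition sys_power :: "'n::finite system \<Rightarrow> 'n monom \<Rightarrow> 'n mpoly"
  where "sys_power Q \<beta> = (\<Prod>i\<in>UNIV. (Q $ i) ^ lookup \<beta> i)"

lemma sys_power_0 [simp]: "sys_power Q 0 = 1"
  by (simp add: sys_power_def)

lemma sys_power_add_single: "sys_power Q (\<beta> + single i 1) = sys_power Q \<beta> * Q $ i"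
  by (simp add: sys_power_def lookup_add power_add prod.distrib prod_power_single)

lemma weighted_sys_power:
  assumes "\<And>i. Q $ i \<in> weighted w d"
  shows "sys_power Q \<beta> \<in> weighted w (d * mdeg \<beta>)"
  using weighted_prod_power[of "($) Q" w "\<lambda>_. d" \<beta>] assms
  by (simp add: sys_power_def wdeg_def mdeg_def sum_distrib_left)

text \<open>Writing \<open>p\<close> as a combination of \<open>B\<close> plus a combination of the
  generators turns \<open>sys_power Q \<beta> * p\<close> into elements of \<open>C\<close> and
  products with one more generator. Iterating until \<open>s\<close> generators are collected ends
  in \<open>Z\<close>, which stands for any subspace containing the \<open>s\<close>-th power of the
  ideal and all terms of high degree. So the codimension of \<open>Z\<close> is at most the size of
  \<open>B\<close> times the number of monomials of degree less than \<open>s\<close>.\<close>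

lemma spans_mod_powers:
  fixes Q :: "'n::finite system" and B :: "'n mpoly set"
  assumes B: "spans_mod B (sys_ideal Q) M" and Z: "mp.subspace Z" "order_ge M \<subseteq> Z"
    and powers: "\<And>\<beta> p. s \<le> mdeg \<beta> \<Longrightarrow> sys_power Q \<beta> * p \<in> Z"
    and C: "C = (\<lambda>(b, \<beta>). sys_power Q \<beta> * b) ` (B \<times> {\<beta>. mdeg \<beta> < s})"
  shows "\<exists>q\<in>mp.span C. sys_power Q \<beta> * p - q \<in> Z"
proof (induction "s - mdeg \<beta>" arbitrary: \<beta> p rule: less_induct)
  case less
  show ?case
  proof (cases "mdeg \<beta> < s")
    case False
    then have "sys_power Q \<beta> * p - 0 \<in> Z" using powers by simp
    then show ?thesis using mp.span_zero by blast
  next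
    case True
    obtain q r where qr: "q \<in> mp.span B" "r \<in> sys_ideal Q" "p - q - r \<in> order_ge M"
      using B unfolding spans_mod_def by blast
    then obtain u where u: "r = (\<Sum>i\<in>UNIV. u i * Q $ i)"
      by (auto simp: sys_ideal_def)
    have "\<exists>q\<in>mp.span C. sys_power Q (\<beta> + single i 1) * u i - q \<in> Z" for i
      by (rule less) (use True in \<open>simp add: mdeg_add\<close>)
    then obtain q' where q': "\<And>i. q' i \<in> mp.span C"
        "\<And>i. sys_power Q (\<beta> + single i 1) * u i - q' i \<in> Z"
      by metis
    have "sys_power Q \<beta> * b \<in> C" if "b \<in> B" for b
      unfolding C by (rule image_eqI[of _ _ "(b, \<beta>)"]) (use that True in auto)
    then have "mp.span B \<subseteq> {q. sys_power Q \<beta> * q \<in> mp.span C}"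
      by (intro mp.span_minimal)
        (auto simp: mp.subspace_def ring_distribs mult.left_commute[of _ "Const _"]
          intro: mp.span_base mp.span_add mp.span_scale mp.span_zero)
    then have q: "sys_power Q \<beta> * q \<in> mp.span C" using qr(1) by blast
    define q0 where "q0 = sys_power Q \<beta> * q + (\<Sum>i\<in>UNIV. q' i)"
    have "q0 \<in> mp.span C"
      unfolding q0_def by (intro mp.span_add mp.span_sum q q')
    moreover have "sys_power Q \<beta> * p - q0 =
        (\<Sum>i\<in>UNIV. sys_power Q (\<beta> + single i 1) * u i - q' i) + sys_power Q \<beta> * (p - q - r)"
      by (simp only: q0_def u sys_power_add_single)
        (simp add: algebra_simps sum_subtractf sum_distrib_left)
    moreover have "\<dots> \<in> Z"
      by (intro mp.subspace_add[OF Z(1)] mp.subspace_sum[OF Z(1)] q' subsetD[OF Z(2)]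
        weighted_mult_left qr(3))
    ultimately show ?thesis by metis
  qed
qed

section \<open>Counting monomials of bounded weight\<close>

lemma lookup_Abs_poly_mapping_finite [simp]:
  "lookup (Abs_poly_mapping (f :: 'n::finite \<Rightarrow> nat)) = f"
  by (rule lookup_Abs_poly_mapping) (rule finite_subset[OF subset_UNIV], simp)

lemma mdeg_le_wdeg: "(\<And>i. 1 \<le> w i) \<Longrightarrow> mdeg m \<le> wdeg w m"
  unfolding mdeg_def wdeg_def by (rule sum_mono) (metis mult_le_mono1 nat_mult_1)

lemma lookup_le_mdeg: "lookup m i \<le> mdeg m"
  unfolding mdeg_def by (rule member_le_sum) auto

text \<open>A monomial in the top \<open>k\<close> degrees is determined by its degree and its
  exponents at all variables but one: at most \<open>k\<close> degrees and at most \<open>s\<close>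
  values for each of the \<open>CARD('n) - 1\<close> exponents.\<close>

lemma card_mdeg_less_diff:
  "card {m :: 'n::finite monom. mdeg m < s} \<le>
    card {m :: 'n monom. mdeg m < s - k} + k * s ^ (CARD('n) - 1)"
proof -
  obtain i0 :: 'n where True by simp
  let ?S = "{m :: 'n monom. s - k \<le> mdeg m \<and> mdeg m < s}"
  define h where "h m = (mdeg m, restrict (lookup m) (- {i0}))" for m :: "'n monom"
  have mdeg: "mdeg m = lookup m i0 + (\<Sum>i\<in>- {i0}. lookup m i)" for m :: "'n monom"
    unfolding mdeg_def by (subst sum.remove[of _ i0]) (auto simp: Compl_eq_Diff_UNIV)
  have "inj_on h ?S"
  proof (rule inj_onI)
    fix m m' assume h: "h m = h m'"
    have eq: "lookup m i = lookup m' i" if "i \<noteq> i0" for i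
      using h that by (auto simp: h_def dest!: fun_cong[where x = i])
    then have "(\<Sum>i\<in>- {i0}. lookup m i) = (\<Sum>i\<in>- {i0}. lookup m' i)"
      by (intro sum.cong) auto
    then have "lookup m i0 = lookup m' i0"
      using h mdeg[of m] mdeg[of m'] by (simp add: h_def)
    then show "m = m'" using eq by (metis poly_mapping_eqI)
  qed
  moreover have "h ` ?S \<subseteq> {s - k..<s} \<times> (- {i0} \<rightarrow>\<^sub>E {..<s})"
    by (auto simp: h_def restrict_def intro: le_less_trans[OF lookup_le_mdeg] split: if_splits)
  ultimately have "card ?S \<le> card ({s - k..<s} \<times> (- {i0} \<rightarrow>\<^sub>E {..<s}))"
    by (intro card_inj_on_le) (auto intro!: finite_PiE)
  also have "\<dots> \<le> k * s ^ (CARD('n) - 1)"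
    by (auto simp: card_cartesian_product card_PiE Compl_eq_Diff_UNIV card_Diff_singleton)
  finally have "card ?S \<le> k * s ^ (CARD('n) - 1)" .
  moreover have "card {m :: 'n monom. mdeg m < s} \<le> card ({m :: 'n monom. mdeg m < s - k} \<union> ?S)"
    by (intro card_mono finite_UnI finite_mdeg_less finite_subset[OF _ finite_mdeg_less[of s]]) auto
  moreover have "\<dots> \<le> card {m :: 'n monom. mdeg m < s - k} + card ?S"
    by (rule card_Un_le)
  ultimately show ?thesis by linarith
qed

context
  fixes K :: "'n::finite set" and i0 :: 'n and d :: nat and w v :: "'n \<Rightarrow> nat"
  assumes i0: "i0 \<in> K" and d: "1 \<le> d"
  defines "w \<equiv> \<lambda>i. if i \<in> K then 1 else d"
    and "v \<equiv> \<lambda>i. if i = i0 then 1 else if i \<in> K then 2 else d + 1"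
begin

text \<open>Exponents at \<open>K\<close> are divided by \<open>d\<close> with remainder
  \<open>r\<close>; the quotients and the exponents outside \<open>K\<close> form
  \<open>\<beta>\<close>. The weight is then \<open>d * mdeg \<beta>\<close> plus the sum of the
  remainders, and lowering the degree bound by \<open>card K\<close> makes room for that
  sum.\<close>

lemma card_weight_less_lower:
  "d ^ card K * card {m :: 'n monom. mdeg m < s - card K} \<le> card {m. wdeg w m < s * d}"
proof -
  define h where "h = (\<lambda>(r, \<beta>). Abs_poly_mapping
    (\<lambda>i. if i \<in> K then d * lookup \<beta> i + r i else lookup (\<beta> :: 'n monom) i))"
  let ?D = "(K \<rightarrow>\<^sub>E {..<d}) \<times> {m :: 'n monom. mdeg m < s - card K}"
  have h: "lookup (h (r, \<beta>)) = (\<lambda>i. if i \<in> K then d * lookup \<beta> i + r i else lookup \<beta> i)" for r \<beta>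
    by (simp add: h_def)
  have "inj_on h ?D"
  proof (rule inj_onI, safe)
    fix r \<beta> r' \<beta>'
    assume r: "r \<in> K \<rightarrow>\<^sub>E {..<d}" "r' \<in> K \<rightarrow>\<^sub>E {..<d}" and "h (r, \<beta>) = h (r', \<beta>')"
    then have eq: "(if i \<in> K then d * lookup \<beta> i + r i else lookup \<beta> i) =
        (if i \<in> K then d * lookup \<beta>' i + r' i else lookup \<beta>' i)" for i
      using h by metis
    have "r i = r' i \<and> lookup \<beta> i = lookup \<beta>' i" if "i \<in> K" for i
    proof -
      have lt: "r i < d" "r' i < d" using r that by auto
      have e: "d * lookup \<beta> i + r i = d * lookup \<beta>' i + r' i" using eq[of i] that by simp
      show ?thesis
        using arg_cong[OF e, of "\<lambda>x. x mod d"] arg_cong[OF e, of "\<lambda>x. x div d"] lt by simp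
    qed
    then show "r = r'" "\<beta> = \<beta>'"
      using eq by (blast intro: PiE_ext[OF r], metis poly_mapping_eqI)
  qed
  moreover have "h ` ?D \<subseteq> {m. wdeg w m < s * d}"
  proof safe
    fix r and \<beta> :: "'n monom"
    assume r: "r \<in> K \<rightarrow>\<^sub>E {..<d}" and \<beta>: "mdeg \<beta> < s - card K"
    have "wdeg w (h (r, \<beta>)) = (\<Sum>i\<in>UNIV. d * lookup \<beta> i + (if i \<in> K then r i else 0))"
      unfolding wdeg_def h by (intro sum.cong) (auto simp: w_def)
    also have "\<dots> = d * mdeg \<beta> + (\<Sum>i\<in>K. r i)"
      by (simp add: sum.distrib sum_distrib_left mdeg_def sum.If_cases)
    also have "(\<Sum>i\<in>K. r i) \<le> (\<Sum>i\<in>K. d)"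
      by (rule sum_mono) (use r in \<open>fastforce simp: PiE_def Pi_def\<close>)
    also have "d * mdeg \<beta> + (\<Sum>i\<in>K. d) = (mdeg \<beta> + card K) * d"
      by (simp add: algebra_simps)
    also have "\<dots> < s * d"
      using \<beta> d by (intro mult_strict_right_mono) auto
    finally show "wdeg w (h (r, \<beta>)) < s * d" by simp
  qed
  moreover have "finite {m. wdeg w m < s * d}"
    by (rule finite_subset[OF _ finite_mdeg_less[of "s * d"]])
      (use d in \<open>auto intro: le_less_trans[OF mdeg_le_wdeg[of w]] simp: w_def\<close>)
  ultimately have "card ?D \<le> card {m. wdeg w m < s * d}"
    by (rule card_inj_on_le)
  then show ?thesis
    by (simp add: card_cartesian_product card_PiE)
qed

text \<open>The monomials counted are \<open>s * d\<close> copies of the variable \<open>i0\<close>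
  times a monomial with all exponents below \<open>t\<close>. The power alone has first weight
  \<open>s * d\<close>, while in the second weight the other factor adds at most
  \<open>CARD('n) * (d + 1) * t\<close>, which the choice of \<open>s\<close> makes smaller than
  \<open>s\<close>.\<close>

lemma card_weight_extra_lower:
  assumes s: "s = (1 + CARD('n) * (d + 1)) * t"
  shows "t ^ CARD('n) \<le> card {m. s * d \<le> wdeg w m \<and> wdeg v m < s * (d + 1)}" (is "_ \<le> card ?A")
proof -
  define h where "h f = Abs_poly_mapping (\<lambda>i. f i + (if i = i0 then s * d else 0))" for f :: "'n \<Rightarrow> nat"
  have h: "lookup (h f) = (\<lambda>i. f i + (if i = i0 then s * d else 0))" for f
    by (simp add: h_def)
  have "inj_on h (UNIV \<rightarrow>\<^sub>E {..<t})"
    by (rule inj_onI) (metis h add_right_cancel ext)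
  moreover have "h ` (UNIV \<rightarrow>\<^sub>E {..<t}) \<subseteq> ?A"
  proof safe
    fix f :: "'n \<Rightarrow> nat" assume "f \<in> UNIV \<rightarrow>\<^sub>E {..<t}"
    then have f: "f i < t" for i by auto
    have "s * d \<le> w i0 * lookup (h f) i0" using i0 by (simp add: h w_def)
    also have "\<dots> \<le> wdeg w (h f)"
      unfolding wdeg_def by (rule member_le_sum) auto
    finally show "s * d \<le> wdeg w (h f)" .
    have "wdeg v (h f) = (\<Sum>i\<in>UNIV. v i * f i + (if i = i0 then s * d else 0))"
      unfolding wdeg_def h by (intro sum.cong) (auto simp: v_def)
    also have "\<dots> = (\<Sum>i\<in>UNIV. v i * f i) + s * d"
      by (simp add: sum.distrib)
    also have "(\<Sum>i\<in>UNIV. v i * f i) \<le> (\<Sum>i\<in>(UNIV :: 'n set). (d + 1) * t)"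
    proof (rule sum_mono)
      fix i
      have "v i \<le> d + 1" using d by (simp add: v_def)
      then show "v i * f i \<le> (d + 1) * t" using f[of i] by (intro mult_le_mono) auto
    qed
    \<comment> \<open>The gap between the two sides is exactly \<open>t\<close>, which is positive
      because \<open>f i0 < t\<close>.\<close>
    also have "(\<Sum>i\<in>(UNIV :: 'n set). (d + 1) * t) + s * d < s * (d + 1)"
      using f[of i0] by (simp add: s algebra_simps)
    finally show "wdeg v (h f) < s * (d + 1)" by simp
  qed
  moreover have "finite ?A"
    by (rule finite_subset[OF _ finite_mdeg_less[of "s * (d + 1)"]])
      (auto intro: le_less_trans[OF mdeg_le_wdeg[of v]] simp: v_def)
  ultimately have "card (UNIV \<rightarrow>\<^sub>E {..<t} :: ('n \<Rightarrow> nat) set) \<le> card ?A"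
    by (rule card_inj_on_le)
  then show ?thesis by (simp add: card_PiE)
qed

end

section \<open>Colength of powers of an ideal and the monomials they avoid\<close>

context monomial_order
begin

text \<open>The monomials of \<open>?A\<close> are independent modulo the polynomials
  \<open>Z\<close> in which none of them occurs. By the weight bounds \<open>Z\<close> contains the
  products of at least \<open>s\<close> generators, so the spanning set \<open>C\<close> of
  \<open>spans_mod_powers\<close> bounds their number.\<close>

lemma card_weight_less_upper:
  assumes Qw: "\<And>i. Q $ i \<in> weighted w d" and Qv: "\<And>i. Q $ i \<in> weighted v d'"
    and w: "\<And>i. 1 \<le> w i" and v: "\<And>i. 1 \<le> v i"
    and card: "\<And>M. card (std_below le (sys_ideal Q) M) \<le> e"
  shows "card {m. wdeg w m < s * d \<or> wdeg v m < s * d'} \<le> e * card {m :: 'n monom. mdeg m < s}"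
proof (rule ccontr)
  \<comment> \<open>All weights are at least 1, so every monomial of \<open>?A\<close> has degree
    less than \<open>M\<close> and truncating at \<open>M\<close> loses none of them.\<close>
  define M where "M = s * (d + d')"
  let ?A = "{m. wdeg w m < s * d \<or> wdeg v m < s * d'}"
  let ?B = "(\<lambda>m. single m (1 :: complex)) ` std_below le (sys_ideal Q) M"
  let ?N = "{\<beta> :: 'n monom. mdeg \<beta> < s}"
  define C where "C = (\<lambda>(b, \<beta>). sys_power Q \<beta> * b) ` (?B \<times> ?N)"
  define Z where "Z = {p :: 'n mpoly. \<forall>m\<in>?A. mdeg m < M \<longrightarrow> lookup p m = 0}"
  assume "\<not> card ?A \<le> e * card ?N"
  have "mdeg m < M" if "m \<in> ?A" for m
  proof -
    have "mdeg m \<le> wdeg w m" "mdeg m \<le> wdeg v m" using mdeg_le_wdeg w v by blast+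
    then show ?thesis using that by (auto simp: M_def ring_distribs)
  qed
  then have A: "finite ?A" "\<And>m. m \<in> ?A \<Longrightarrow> mdeg m < M"
    by (auto intro: finite_subset[OF _ finite_mdeg_less[of M]])
  have "card C \<le> card (?B \<times> ?N)"
    unfolding C_def by (rule card_image_le) simp
  also have "\<dots> = card ?B * card ?N" by (rule card_cartesian_product)
  also have "\<dots> \<le> e * card ?N"
    by (intro mult_le_mono1 order_trans[OF card_image_le card[of M]]) simp
  finally have "card C < card ?A" using \<open>\<not> _\<close> by simp
  have Z: "mp.subspace Z"
    by (auto simp: mp.subspace_def Z_def lookup_add)
  have ZM: "order_ge M \<subseteq> Z"
    by (auto simp: Z_def weighted_iff mdeg_wdeg)
  have Zpow: "sys_power Q \<beta> * p \<in> Z" if "s \<le> mdeg \<beta>" for \<beta> p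
  proof -
    have "sys_power Q \<beta> * p \<in> weighted w (s * d)" "sys_power Q \<beta> * p \<in> weighted v (s * d')"
      using weighted_mono[OF weighted_mult_left[OF weighted_sys_power[OF Qw, of \<beta>]], of "s * d" p]
        weighted_mono[OF weighted_mult_left[OF weighted_sys_power[OF Qv, of \<beta>]], of "s * d'" p]
        that by (simp_all add: mult.commute)
    then show ?thesis unfolding Z_def weighted_iff by blast
  qed
  have "\<exists>q\<in>mp.span C. sys_power Q 0 * single m 1 - q \<in> Z" for m
    by (rule spans_mod_powers[OF std_spans[OF subspace_sys_ideal] Z ZM Zpow C_def])
  then obtain c where c: "\<exists>m\<in>?A. c m \<noteq> 0" "(\<Sum>m\<in>?A. Const (c m) * single m 1) \<in> Z"
    using exists_combination_in_subspace[OF A(1) _ \<open>card C < card ?A\<close> Z, of "\<lambda>m. single m 1"]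
    by (auto simp: C_def)
  then obtain m where m: "m \<in> ?A" "c m \<noteq> 0" by blast
  have "lookup (\<Sum>m\<in>?A. Const (c m) * single m 1) m = 0"
    using c(2) m(1) A(2)[OF m(1)] unfolding Z_def by blast
  then show False
    using m by (simp only: lookup_sum_single_family[OF A(1)] if_True)
qed

text \<open>Counting the monomials that powers of the ideal avoid: the first weight alone accounts
  for \<open>d ^ card K * s ^ n / n!\<close> of them asymptotically, which is already all that the
  colength allows, and the second weight adds a positive proportion of \<open>s ^ n\<close>.\<close>
lemma no_tangent_direction:
  fixes Q :: "'n system" and K :: "'n set" and i0 :: 'n and d :: nat
  defines "w \<equiv> \<lambda>i. if i \<in> K then 1 else d"
    and "v \<equiv> \<lambda>i. if i = i0 then 1 else if i \<in> K then 2 else d + 1"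
  assumes i0: "i0 \<in> K" and d: "1 \<le> d"
    and Qw: "\<And>i. Q $ i \<in> weighted w d" and Qv: "\<And>i. Q $ i \<in> weighted v (d + 1)"
    and card: "\<And>M. card (std_below le (sys_ideal Q) M) \<le> d ^ card K"
  shows False
proof -
  define N where "N s = card {m :: 'n monom. mdeg m < s}" for s
  define e where "e = d ^ card K"
  define n where "n = CARD('n)"
  define C where "C = 1 + n * (d + 1)"
  \<comment> \<open>Large enough to contradict the final estimate, in which \<open>t ^ n\<close> is
    bounded by the factor \<open>e * card K * C ^ (n - 1)\<close> times
    \<open>t ^ (n - 1)\<close>.\<close>
  define t where "t = e * card K * C ^ (n - 1) + 1"
  define s where "s = C * t"
  let ?A1 = "{m. wdeg w m < s * d}"
    and ?A2 = "{m. s * d \<le> wdeg w m \<and> wdeg v m < s * (d + 1)}"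
    and ?A = "{m. wdeg w m < s * d \<or> wdeg v m < s * (d + 1)}"
  have wv: "1 \<le> w i" "1 \<le> v i" for i
    using d by (simp_all add: w_def v_def)
  have "finite ?A1" "finite ?A2"
    by (rule finite_subset[OF _ finite_mdeg_less[of "s * (d + 1)"]],
        use wv mdeg_le_wdeg[of w] mdeg_le_wdeg[of v] in \<open>fastforce dest: le_less_trans\<close>)+
  moreover have "?A = ?A1 \<union> ?A2" "?A1 \<inter> ?A2 = {}" by auto
  ultimately have "card ?A1 + card ?A2 = card ?A"
    by (simp add: card_Un_disjoint)
  also have "\<dots> \<le> e * N s"
    unfolding N_def e_def by (rule card_weight_less_upper[OF Qw Qv wv card])
  also have "\<dots> \<le> e * (N (s - card K) + card K * s ^ (n - 1))"
    unfolding N_def n_def by (intro mult_le_mono2 card_mdeg_less_diff)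
  finally have "card ?A1 + card ?A2 \<le> e * N (s - card K) + e * card K * s ^ (n - 1)"
    by (simp add: algebra_simps)
  moreover have "e * N (s - card K) \<le> card ?A1"
    using card_weight_less_lower[OF i0 d, of s] by (simp add: w_def N_def e_def)
  moreover have "t ^ n \<le> card ?A2"
    using card_weight_extra_lower[OF i0 d, of s t] by (simp add: w_def v_def n_def s_def C_def)
  \<comment> \<open>The main term \<open>e * N (s - card K)\<close> occurs on both sides and
    cancels; only the error of order \<open>s ^ (n - 1)\<close> remains to bound the extra
    monomials.\<close>
  ultimately have "t ^ n \<le> e * card K * C ^ (n - 1) * t ^ (n - 1)"
    by (simp add: s_def power_mult_distrib)
  also have "\<dots> < t * t ^ (n - 1)"
    by (intro mult_strict_right_mono) (auto simp: t_def)
  also have "\<dots> = t ^ n"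
    by (metis n_def power_eq_if zero_less_card_finite less_numeral_extra(3))
  finally show False by simp
qed

end

section \<open>Initial forms of a system in normal form\<close>

text \<open>The monomials counted by the coefficient of \<open>fps_X ^ k\<close> in
  \<open>(\<Sum>i<d. fps_X ^ i) ^ card A\<close>.\<close>

definition box_monoms :: "'n::finite set \<Rightarrow> nat \<Rightarrow> nat \<Rightarrow> 'n monom set"
  where "box_monoms A d k = {m. keys m \<subseteq> A \<and> (\<forall>i\<in>A. lookup m i < d) \<and> mdeg m = k}"

lemma finite_box_monoms [simp]: "finite (box_monoms A d k)"
  by (rule finite_subset[OF _ finite_mdeg_less[of "Suc k"]]) (auto simp: box_monoms_def)

text \<open>As a product over \<open>A\<close>, each factor records the exponent of one variable.
  The induction splits the box monomials by their exponent at the new variable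
  \<open>a\<close>.\<close>

lemma prod_geometric_nth:
  fixes A :: "'n::finite set"
  shows "fps_nth (\<Prod>a\<in>A. \<Sum>i<d. fps_X ^ i :: int fps) k = int (card (box_monoms A d k))"
proof -
  have "finite A" by simp
  then show ?thesis
  proof (induction A arbitrary: k rule: finite_induct)
    case empty
    have "box_monoms {} d k = (if k = 0 then {0 :: 'n monom} else {})"
    proof -
      have "keys m \<subseteq> {} \<longleftrightarrow> m = 0" for m :: "'n monom"
        using poly_mapping_sum_singles[of m] by auto
      then show ?thesis by (auto simp: box_monoms_def)
    qed
    then show ?case by simp
  next
    case (insert a A)
    let ?F = "\<Prod>a\<in>A. \<Sum>i<d. fps_X ^ i :: int fps"
    let ?I = "{i. i < d \<and> i \<le> k}"
    have a: "lookup m a = 0" if "m \<in> box_monoms A d k'" for m k'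
      using that insert.hyps(2) by (auto simp: box_monoms_def in_keys_iff)
    have union: "box_monoms (insert a A) d k = (\<Union>i\<in>?I. (\<lambda>m. m + single a i) ` box_monoms A d (k - i))"
    proof safe
      fix m assume m: "m \<in> box_monoms (insert a A) d k"
      let ?i = "lookup m a" and ?m = "m - single a (lookup m a)"
      have *: "m = ?m + single a ?i"
        by (rule poly_mapping_eqI) (auto simp: lookup_add lookup_minus lookup_single when_def)
      then have "mdeg m = mdeg ?m + ?i" by (metis mdeg_add mdeg_single)
      then have deg: "?i \<le> k" "mdeg ?m = k - ?i"
        using m by (auto simp: box_monoms_def)
      have "?m \<in> box_monoms A d (k - ?i)"
        using m deg unfolding box_monoms_def
        by (auto simp: subset_iff in_keys_iff lookup_minus lookup_single when_def split: if_splits)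
      moreover have "?i \<in> ?I" using m deg by (auto simp: box_monoms_def)
      ultimately show "m \<in> (\<Union>i\<in>?I. (\<lambda>m. m + single a i) ` box_monoms A d (k - i))"
        using * by blast
    next
      fix i m assume "i < d" "i \<le> k" "m \<in> box_monoms A d (k - i)"
      then show "m + single a i \<in> box_monoms (insert a A) d k"
        using a[of m "k - i"] insert.hyps(2)
        by (auto simp: box_monoms_def mdeg_add subset_iff in_keys_iff lookup_add lookup_single when_def split: if_splits)
    qed
    have "card (box_monoms (insert a A) d k) =
        (\<Sum>i\<in>?I. card ((\<lambda>m. m + single a i) ` box_monoms A d (k - i)))"
      unfolding union
    proof (rule card_UN_disjoint)
      have "(m + single a i) \<noteq> m' + single a j"
        if "m \<in> box_monoms A d (k - i)" "m' \<in> box_monoms A d (k - j)" "i \<noteq> j" for m m' i j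
        using a[OF that(1)] a[OF that(2)] that(3)
        by (metis add_0 lookup_add lookup_single_eq)
      then show "\<forall>i\<in>?I. \<forall>j\<in>?I. i \<noteq> j \<longrightarrow> (\<lambda>m. m + single a i) ` box_monoms A d (k - i) \<inter>
           (\<lambda>m. m + single a j) ` box_monoms A d (k - j) = {}"
        by blast
    qed auto
    also have "\<dots> = (\<Sum>i\<in>?I. card (box_monoms A d (k - i)))"
      by (intro sum.cong card_image) (auto intro: inj_onI)
    finally have "int (card (box_monoms (insert a A) d k)) = (\<Sum>i\<in>?I. fps_nth ?F (k - i))"
      by (simp only: insert.IH of_nat_sum)
    also have "\<dots> = (\<Sum>i<d. if k < i then 0 else fps_nth ?F (k - i))"
      by (intro sum.mono_neutral_cong_left) auto
    also have "\<dots> = fps_nth ((\<Sum>i<d. fps_X ^ i) * ?F) k"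
      by (simp only: sum_distrib_right fps_sum_nth fps_X_power_mult_nth)
    finally show ?case by (simp only: prod.insert[OF insert.hyps])
  qed
qed

lemma hilbert_series_eq_iff:
  fixes K :: "'n::finite set"
  shows "hilbert_series le I = (\<Sum>i<d. fps_X ^ i) ^ card K \<longleftrightarrow>
    (\<forall>k. card {m \<in> standard_monoms le I. mdeg m = k} = card (box_monoms K d k))"
  using prod_geometric_nth[of d K] by (simp add: hilbert_series_def fps_eq_iff)

text \<open>All box monomials together correspond to the functions from \<open>K\<close> to
  \<open>{..<d}\<close>: this is the value at 1 of the Hilbert series.\<close>

lemma (in monomial_order) card_std_below_le_power:
  assumes "\<And>k. card {m \<in> standard_monoms le I. mdeg m = k} = card (box_monoms K d k)"
  shows "card (std_below le I M) \<le> d ^ card K"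
proof -
  have "card (std_below le I M) = (\<Sum>k<M. card (box_monoms K d k))"
  proof (induction M)
    case 0
    then show ?case by (simp add: std_below_def)
  next
    case (Suc M)
    then show ?case by (simp add: card_std_below_Suc assms)
  qed
  also have "\<dots> = card (\<Union>k<M. box_monoms K d k)"
    by (rule card_UN_disjoint[symmetric]) (simp_all, auto simp: box_monoms_def)
  also have "\<dots> \<le> card (K \<rightarrow>\<^sub>E {..<d})"
  proof (rule card_inj_on_le)
    show "inj_on (\<lambda>m. restrict (lookup m) K) (\<Union>k<M. box_monoms K d k)"
    proof (rule inj_onI)
      fix m m' assume m: "m \<in> (\<Union>k<M. box_monoms K d k)" "m' \<in> (\<Union>k<M. box_monoms K d k)"
        and eq: "restrict (lookup m) K = restrict (lookup m') K"
      show "m = m'"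
      proof (rule poly_mapping_eqI)
        fix i show "lookup m i = lookup m' i"
        proof (cases "i \<in> K")
          case True
          then show ?thesis using fun_cong[OF eq, of i] by simp
        next
          case False
          then have "i \<notin> keys m" "i \<notin> keys m'" using m by (auto simp: box_monoms_def)
          then show ?thesis by (simp add: in_keys_iff)
        qed
      qed
    qed
    show "(\<lambda>m. restrict (lookup m) K) ` (\<Union>k<M. box_monoms K d k) \<subseteq> K \<rightarrow>\<^sub>E {..<d}"
      by (auto simp: box_monoms_def)
  qed (simp add: finite_PiE)
  also have "\<dots> = d ^ card K" by (simp add: card_PiE)
  finally show ?thesis .
qed

text \<open>Here \<open>K\<close> is the set of indices of the variables \<open>x\<^sub>1, \<dots>, x\<^sub>\<kappa>\<close>; the last two conjuncts are the
  conditions (ii) and (iii) of a pre-inflatable system.\<close>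
definition normal_form :: "'n::finite set \<Rightarrow> nat \<Rightarrow> nat \<Rightarrow> 'n system \<Rightarrow> bool"
  where "normal_form K k l P \<longleftrightarrow>
    (\<forall>i\<in>K. P $ i \<in> order_ge 2) \<and> (\<forall>j. j \<notin> K \<longrightarrow> P $ j - Var j \<in> order_ge 2) \<and>
    (\<forall>i\<in>K. \<forall>m\<in>keys (P $ i). \<not> keys m \<subseteq> K \<longrightarrow> k < mdeg m) \<and>
    (\<forall>j. j \<notin> K \<longrightarrow> (\<forall>m\<in>keys (P $ j). keys m \<subseteq> K \<longrightarrow> l < mdeg m))"

lemma lookup_single_mult: "lookup (single m' 1 * p) (m' + m) = lookup p m"
  for p :: "'n mpoly"
proof (induction p rule: mpoly_induct)
  case (single m0 a)
  then show ?case by (simp add: mult_single lookup_single when_def)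
qed (simp add: ring_distribs lookup_add)

lemma single_single_eq_iff: "single i (Suc 0) = single j (Suc 0) \<longleftrightarrow> i = j"
  by (metis lookup_single_eq lookup_single_not_eq nat.distinct(1))

lemma is_initial_monom_shift:
  assumes "monomial_order le" "is_initial_monom le p m"
  shows "is_initial_monom le (single m' 1 * p) (m' + m)"
proof -
  interpret monomial_order le by fact
  show ?thesis
    unfolding is_initial_monom_def
  proof safe
    show "m' + m \<in> keys (single m' 1 * p)"
      using assms(2) by (simp add: is_initial_monom_def in_keys_iff lookup_single_mult)
    fix a assume "a \<in> keys (single m' 1 * p)"
    then obtain b where "b \<in> keys p" "a = m' + b"
      using keys_mult[of "single m' 1" p] by (auto split: if_splits)
    then show "le a (m' + m)"
      using assms(2) le_add[of b m m'] by (auto simp: is_initial_monom_def add.commute)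
  qed
qed

lemma mdeg_less_2:
  assumes "mdeg m < 2"
  shows "m = 0 \<or> (\<exists>i. m = single i 1)"
proof (cases "m = 0")
  case False
  then obtain i where i: "lookup m i \<noteq> 0" by (metis poly_mapping_eqI lookup_zero)
  have *: "m = (m - single i 1) + single i 1"
    by (rule poly_mapping_eqI) (use i in \<open>auto simp: lookup_add lookup_minus lookup_single when_def\<close>)
  then have "mdeg m = mdeg (m - single i 1) + 1" by (metis mdeg_add mdeg_single)
  then have "mdeg (m - single i 1) = 0" using assms by simp
  then have "m - single i 1 = 0" by (simp add: mdeg_wdeg wdeg_one_eq_0_iff)
  then show ?thesis using * by auto
qed simp

lemma keys_Var [simp]: "keys (Var i) = {single i 1}"
  by (simp add: Var_def)

lemma normal_form_keys_Var:
  assumes "normal_form K k l P" "j \<notin> K"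
  shows "lookup (P $ j) (single j 1) = 1" "m \<in> keys (P $ j) \<Longrightarrow> m \<noteq> single j 1 \<Longrightarrow> 2 \<le> mdeg m"
proof -
  have 1: "P $ j - Var j \<in> order_ge 2" using assms by (simp add: normal_form_def)
  have 2: "lookup (P $ j) m = lookup (Var j) m" if "mdeg m < 2" for m
    using 1 that by (simp add: weighted_iff mdeg_wdeg lookup_minus)
  show "lookup (P $ j) (single j 1) = 1" by (subst 2) (simp_all add: Var_def)
  show "2 \<le> mdeg m" if "m \<in> keys (P $ j)" "m \<noteq> single j 1"
    using 2[of m] that by (cases "mdeg m < 2") (auto simp: in_keys_iff Var_def lookup_single when_def)
qed

lemma wdeg_supported: "keys m \<subseteq> K \<Longrightarrow> (\<And>i. i \<in> K \<Longrightarrow> w i = 1) \<Longrightarrow> wdeg w m = mdeg m"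
  unfolding wdeg_def mdeg_def by (rule sum.cong) (auto simp: in_keys_iff)

lemma wdeg_ge_weight: "i \<in> keys m \<Longrightarrow> w i \<le> wdeg w m"
proof -
  assume "i \<in> keys m"
  then have "w i \<le> w i * lookup m i" by (simp add: in_keys_iff)
  also have "\<dots> \<le> wdeg w m" unfolding wdeg_def by (rule member_le_sum) auto
  finally show ?thesis .
qed

text \<open>One variable outside \<open>K\<close> already contributes weight \<open>N\<close>, so
  only monomials in the variables of \<open>K\<close> have to be checked.\<close>

lemma weighted_if_supported:
  assumes "\<And>m. m \<in> keys p \<Longrightarrow> keys m \<subseteq> K \<Longrightarrow> N \<le> mdeg m"
  shows "p \<in> weighted (\<lambda>i. if i \<in> K then 1 else N) N"
  unfolding weighted_def
proof safe
  fix m assume m: "m \<in> keys p"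
  show "N \<le> wdeg (\<lambda>i. if i \<in> K then 1 else N) m"
  proof (cases "keys m \<subseteq> K")
    case True
    then show ?thesis using assms[OF m] by (simp add: wdeg_supported)
  next
    case False
    then obtain i where "i \<in> keys m" "i \<notin> K" by blast
    then show ?thesis using wdeg_ge_weight[of i m "\<lambda>i. if i \<in> K then 1 else N"] by simp
  qed
qed

section \<open>Consequences of the Hilbert series for a normal form\<close>

locale normal_system = monomial_order le for le :: "'n::finite monom \<Rightarrow> 'n monom \<Rightarrow> bool" +
  fixes K :: "'n set" and d :: nat and P :: "'n system"
  assumes nf: "normal_form K d d P"
    and hilbert: "\<And>k. card {m \<in> standard_monoms le (sys_ideal P). mdeg m = k} = card (box_monoms K d k)"
begin

lemma nfD:
  shows "i \<in> K \<Longrightarrow> P $ i \<in> order_ge 2" "j \<notin> K \<Longrightarrow> P $ j - Var j \<in> order_ge 2"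
    "j \<notin> K \<Longrightarrow> m \<in> keys (P $ j) \<Longrightarrow> keys m \<subseteq> K \<Longrightarrow> d < mdeg m"
    "i \<in> K \<Longrightarrow> m \<in> keys (P $ i) \<Longrightarrow> \<not> keys m \<subseteq> K \<Longrightarrow> d < mdeg m"
  using nf by (auto simp: normal_form_def)

text \<open>For \<open>j \<notin> K\<close> the polynomial \<open>P $ j\<close> is
  \<open>Var j\<close> plus terms of order at least 2, so \<open>Var j\<close> is its initial term
  and every multiple of this variable is an initial monomial of the ideal.\<close>

lemma standard_supported:
  assumes "m \<in> standard_monoms le (sys_ideal P)"
  shows "keys m \<subseteq> K"
proof
  fix j assume j: "j \<in> keys m"
  show "j \<in> K"
  proof (rule ccontr)
    assume "j \<notin> K"
    have "is_initial_monom le (P $ j) (single j 1)"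
      unfolding is_initial_monom_def
    proof safe
      show "single j 1 \<in> keys (P $ j)"
        using normal_form_keys_Var(1)[OF nf \<open>j \<notin> K\<close>] by (simp add: in_keys_iff)
      fix m' assume "m' \<in> keys (P $ j)"
      then have "m' = single j 1 \<or> 2 \<le> mdeg m'"
        using normal_form_keys_Var(2)[OF nf \<open>j \<notin> K\<close>] by blast
      then show "le m' (single j 1)" by (auto intro: le_mdeg)
    qed
    from is_initial_monom_shift[OF monomial_order_axioms this, of "m - single j 1"]
    have "is_initial_monom le (single (m - single j 1) 1 * P $ j) m"
    proof -
      have "m - single j 1 + single j 1 = m"
        by (rule poly_mapping_eqI) (use j in \<open>auto simp: lookup_add lookup_minus lookup_single when_def in_keys_iff\<close>)
      then show ?thesis using \<open>is_initial_monom le (single (m - single j 1) 1 * P $ j) (m - single j 1 + single j 1)\<close> by simp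
    qed
    moreover have "single (m - single j 1) 1 * P $ j \<in> sys_ideal P"
      by (intro sys_ideal_mult sys_ideal_gen)
    ultimately show False using assms by (auto simp: standard_monoms_def)
  qed
qed

text \<open>Give one variable \<open>i\<close> of \<open>K\<close> the weight 1 and all others the
  weight 2. Every generator then has weight at least 2, so the variable \<open>i\<close> occurs
  linearly in no element of the ideal and is a standard monomial of degree 1. For
  \<open>d < 2\<close> the Hilbert series has no term of degree 1.\<close>

lemma two_le_d:
  assumes "K \<noteq> {}"
  shows "2 \<le> d"
proof (rule ccontr)
  assume "\<not> 2 \<le> d"
  obtain i where i: "i \<in> K" using assms by blast
  define w where "w l = (if l = i then 1 else 2 :: nat)" for l
  have gens: "P $ l \<in> weighted w 2" for l
    unfolding weighted_def
  proof safe
    fix m assume m: "m \<in> keys (P $ l)"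
    have le: "mdeg m \<le> wdeg w m" by (rule mdeg_le_wdeg) (simp add: w_def)
    show "2 \<le> wdeg w m"
    proof (cases "l \<in> K")
      case True
      then have "2 \<le> mdeg m" using nfD(1)[of l] m by (auto simp: weighted_def mdeg_wdeg)
      then show ?thesis using le by simp
    next
      case False
      then have "m = single l 1 \<or> 2 \<le> mdeg m" using normal_form_keys_Var(2)[OF nf False m] by blast
      moreover have "l \<noteq> i" using False i by blast
      ultimately show ?thesis using le by (auto simp: w_def)
    qed
  qed
  have "\<not> is_initial_monom le r (single i 1)" if r: "r \<in> sys_ideal P" for r
  proof
    assume "is_initial_monom le r (single i 1)"
    then have key: "single i 1 \<in> keys r" by (simp add: is_initial_monom_def)
    obtain q where "r = (\<Sum>l\<in>UNIV. q l * P $ l)" using r by (auto simp: sys_ideal_def)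
    then have "r \<in> weighted w 2" by (auto intro!: weighted_sum weighted_mult_left gens)
    then show False using key by (auto simp: weighted_def w_def)
  qed
  then have "single i 1 \<in> {m \<in> standard_monoms le (sys_ideal P). mdeg m = 1}"
    by (auto simp: standard_monoms_def)
  moreover have "finite {m \<in> standard_monoms le (sys_ideal P). mdeg m = 1}"
    by (rule finite_subset[OF _ finite_mdeg_less[of 2]]) auto
  ultimately have "card {m \<in> standard_monoms le (sys_ideal P). mdeg m = 1} \<noteq> 0"
    by (auto simp: card_eq_0_iff)
  then have "box_monoms K d 1 \<noteq> {}" using hilbert[of 1] by auto
  then obtain m where m: "keys m \<subseteq> K" "\<forall>i\<in>K. lookup m i < d" "mdeg m = 1"
    by (auto simp: box_monoms_def)
  have "lookup m l = 0" for l
    using m(1,2) \<open>\<not> 2 \<le> d\<close> by (cases "l \<in> K") (auto simp: in_keys_iff)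
  then show False using m(3) by (simp add: mdeg_def)
qed

text \<open>A term of degree less than \<open>d\<close> would make the initial monomial one in the
  variables of \<open>K\<close> of such a degree. But below degree \<open>d\<close> the Hilbert
  series requires all monomials in the variables of \<open>K\<close> to be standard.\<close>

lemma initial_order_ge:
  assumes "i \<in> K"
  shows "P $ i \<in> order_ge d"
  unfolding weighted_def mdeg_wdeg[symmetric]
proof (safe, rule ccontr)
  fix m1 assume m1: "m1 \<in> keys (P $ i)" "\<not> d \<le> mdeg m1"
  then obtain m0 where m0: "is_initial_monom le (P $ i) m0"
    using exists_initial_monom by (metis empty_iff keys_zero)
  then have "le m1 m0" using m1 by (auto simp: is_initial_monom_def)
  then have lt: "mdeg m0 < d" using mdeg_antimono[of m1 m0] m1(2) by simp
  then have K: "keys m0 \<subseteq> K"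
    using nfD(4)[OF assms, of m0] m0 by (auto simp: is_initial_monom_def)
  let ?S = "{m \<in> standard_monoms le (sys_ideal P). mdeg m = mdeg m0}"
  have lookup_lt: "lookup m l < d" if "mdeg m = mdeg m0" for m l
    using lookup_le_mdeg[of m l] that lt by simp
  have "m0 \<in> box_monoms K d (mdeg m0)"
    using K lookup_lt by (auto simp: box_monoms_def)
  moreover have "m0 \<notin> ?S" using m0 sys_ideal_gen[of P i] by (auto simp: standard_monoms_def)
  moreover have "?S \<subseteq> box_monoms K d (mdeg m0)"
    using standard_supported lookup_lt by (fastforce simp: box_monoms_def)
  ultimately have "card ?S < card (box_monoms K d (mdeg m0))"
    by (intro psubset_card_mono) auto
  then show False using hilbert by simp
qed

lemma weighted_generators: "P $ i \<in> weighted (\<lambda>i. if i \<in> K then 1 else d) d"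
proof (rule weighted_if_supported)
  fix m assume "m \<in> keys (P $ i)" "keys m \<subseteq> K"
  then show "d \<le> mdeg m"
    using initial_order_ge[of i] nfD(3)[of i m] by (cases "i \<in> K") (auto simp: weighted_def mdeg_wdeg)
qed

text \<open>The initial monomials of degree \<open>d\<close> in the ideal come from linear combinations of the degree-\<open>d\<close>
  parts of the \<open>P $ i\<close>, \<open>i \<in> K\<close>, and the Hilbert series says that there are \<open>card K\<close> of them.\<close>
lemma exists_degree_d:
  assumes "i0 \<in> K"
  shows "\<exists>m\<in>keys (P $ i0). mdeg m = d"
proof (rule ccontr)
  assume no: "\<not> ?thesis"
  have d: "2 \<le> d" using two_le_d assms by blast
  define X where "X = {m. keys m \<subseteq> K \<and> mdeg m = d}"
  define T where "T = {m \<in> standard_monoms le (sys_ideal P). mdeg m = d}"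
  define K' where "K' = {i \<in> K. \<exists>m\<in>keys (P $ i). mdeg m = d}"
  define B where "B = (\<lambda>i. P $ i) ` K'"
  define Z where "Z = {p :: 'n mpoly. \<forall>m\<in>X. lookup p m = 0}"
  have X: "finite X" by (rule finite_subset[OF _ finite_mdeg_less[of "Suc d"]]) (auto simp: X_def)
  have "T \<subseteq> X" using standard_supported by (auto simp: X_def T_def)
  \<comment> \<open>In degree \<open>d\<close> the only monomials on \<open>K\<close> outside the
    box are the pure powers, one for each element of \<open>K\<close>. Hence exactly
    \<open>card K\<close> monomials of \<open>X\<close> are initial monomials of the ideal.\<close>
  have "m \<in> (\<lambda>i. single i d) ` K" if m: "m \<in> X" "m \<notin> box_monoms K d d" for m
  proof -
    from m obtain i where i: "i \<in> K" "d \<le> lookup m i" by (auto simp: X_def box_monoms_def not_less)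
    have *: "m = (m - single i d) + single i d"
      by (rule poly_mapping_eqI) (use i in \<open>auto simp: lookup_add lookup_minus lookup_single when_def\<close>)
    then have "mdeg m = mdeg (m - single i d) + d" by (metis mdeg_add mdeg_single)
    then have "mdeg (m - single i d) = 0" using m(1) by (simp add: X_def)
    then have "m - single i d = 0" by (simp add: mdeg_wdeg wdeg_one_eq_0_iff)
    then show ?thesis using * i(1) by auto
  qed
  then have "X = box_monoms K d d \<union> (\<lambda>i. single i d) ` K"
    by (auto simp: X_def box_monoms_def split: if_splits)
  moreover have "box_monoms K d d \<inter> (\<lambda>i. single i d) ` K = {}"
    by (auto simp: box_monoms_def)
  moreover have "inj_on (\<lambda>i. single i d) K"
    using d by (intro inj_onI) (metis lookup_single_eq lookup_single_not_eq not_numeral_le_zero)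
  ultimately have "card X = card (box_monoms K d d) + card K"
    by (simp add: card_Un_disjoint card_image)
  moreover have "card T = card (box_monoms K d d)" using hilbert by (simp add: T_def)
  ultimately have card: "card (X - T) = card K"
    using card_Diff_subset[of T X] X \<open>T \<subseteq> X\<close> by (simp add: finite_subset)
  have "K' \<subseteq> K - {i0}" using no by (auto simp: K'_def)
  then have "card K' \<le> card (K - {i0})" by (intro card_mono) auto
  also have "\<dots> < card K" using assms by (intro card_Diff1_less) auto
  finally have B: "finite B" "card B < card (X - T)"
    using card card_image_le[of K' "\<lambda>i. P $ i"] by (auto simp: B_def)
  have Z: "mp.subspace Z" by (auto simp: mp.subspace_def Z_def lookup_add)
  have high: "p \<in> Z" if "p \<in> order_ge (Suc d)" for p
    using that by (auto simp: Z_def X_def weighted_iff mdeg_wdeg)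
  \<comment> \<open>Modulo \<open>Z\<close> only degree-\<open>d\<close> terms on \<open>K\<close>
    count. Generators outside \<open>K\<close> contribute none, and for the others only the constant
    term of the multiplier \<open>u i\<close> matters.\<close>
  have comb: "\<exists>q\<in>mp.span B. r - q \<in> Z" if r: "r \<in> sys_ideal P" for r
  proof -
    obtain u where u: "r = (\<Sum>i\<in>UNIV. u i * P $ i)" using r by (auto simp: sys_ideal_def)
    let ?q = "\<lambda>i. if i \<in> K' then Const (lookup (u i) 0) * P $ i else 0"
    have "u i * P $ i - ?q i \<in> Z" for i
    proof (cases "i \<in> K")
      case False
      have "P $ i \<in> weighted (\<lambda>i. if i \<in> K then 1 else Suc d) (Suc d)"
        by (rule weighted_if_supported) (use nfD(3)[OF False] in \<open>simp add: Suc_le_eq\<close>)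
      then have "u i * P $ i \<in> weighted (\<lambda>i. if i \<in> K then 1 else Suc d) (Suc d)"
        by (rule weighted_mult_left)
      then have "u i * P $ i \<in> Z"
        by (auto simp: weighted_iff Z_def X_def wdeg_supported)
      then show ?thesis using False by (simp add: K'_def)
    next
      case True
      show ?thesis
      proof (cases "i \<in> K'")
        case True
        have "u i - Const (lookup (u i) 0) \<in> order_ge (Suc 0)"
          by (simp add: order_ge_1_iff lookup_minus lookup_Const)
        then have "(u i - Const (lookup (u i) 0)) * P $ i \<in> order_ge (Suc 0 + d)"
          using initial_order_ge[OF \<open>i \<in> K\<close>] by (rule weighted_mult)
        then show ?thesis using True by (intro high) (simp add: left_diff_distrib)
      next
        case False
        have "Suc d \<le> mdeg m" if "m \<in> keys (P $ i)" for m
        proof -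
          have "d \<le> mdeg m" using initial_order_ge[OF \<open>i \<in> K\<close>] that by (auto simp: weighted_def mdeg_wdeg)
          moreover have "mdeg m \<noteq> d" using False \<open>i \<in> K\<close> that by (auto simp: K'_def)
          ultimately show ?thesis by simp
        qed
        then have "P $ i \<in> order_ge (Suc d)"
          by (simp add: weighted_def mdeg_wdeg)
        then show ?thesis using False by (simp add: high weighted_mult_left)
      qed
    qed
    then have "(\<Sum>i\<in>UNIV. u i * P $ i - ?q i) \<in> Z"
      by (rule mp.subspace_sum[OF Z])
    then have "r - (\<Sum>i\<in>UNIV. ?q i) \<in> Z" by (simp only: u sum_subtractf)
    moreover have "(\<Sum>i\<in>UNIV. ?q i) \<in> mp.span B"
      by (intro mp.span_sum) (auto simp: B_def intro: mp.span_scale mp.span_base mp.span_zero)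
    ultimately show ?thesis by blast
  qed
  have "\<exists>g\<in>sys_ideal P. is_initial_monom le g m" if "m \<in> X - T" for m
    using that by (auto simp: X_def T_def standard_monoms_def)
  then obtain g where g: "\<And>m. m \<in> X - T \<Longrightarrow> g m \<in> sys_ideal P"
      "\<And>m. m \<in> X - T \<Longrightarrow> is_initial_monom le (g m) m"
    by metis
  have "finite (X - T)" using X by simp
  have "\<exists>c. (\<exists>m\<in>X - T. c m \<noteq> 0) \<and> (\<Sum>m\<in>X - T. Const (c m) * g m) \<in> Z"
    by (rule exists_combination_in_subspace[OF \<open>finite (X - T)\<close> B Z comb[OF g(1)]])
  then obtain c where c: "\<exists>m\<in>X - T. c m \<noteq> 0" "(\<Sum>m\<in>X - T. Const (c m) * g m) \<in> Z"
    by (elim exE conjE)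
  \<comment> \<open>At the largest monomial of \<open>Y\<close> only one summand has a nonzero
    coefficient, since the other \<open>g a\<close> involved have smaller initial monomials. So the
    combination cannot lie in \<open>Z\<close>.\<close>
  define Y where "Y = {m\<in>X - T. c m \<noteq> 0}"
  have "finite Y" using X by (simp add: Y_def)
  moreover have "Y \<noteq> {}" using c(1) by (auto simp: Y_def)
  ultimately have "\<exists>m\<in>Y. \<forall>a\<in>Y. le a m"
    by (rule finite_has_greatest)
  then obtain m where "m \<in> Y" and max: "\<forall>a\<in>Y. le a m"
    by (elim bexE)
  then have m: "m \<in> X - T" "c m \<noteq> 0" by (simp_all add: Y_def)
  have "lookup (Const (c a) * g a) m = 0" if a: "a \<in> X - T - {m}" for a
  proof (cases "c a = 0")
    case False
    then have "le a m" using max a by (simp add: Y_def)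
    then have "\<not> le m a" using a le_antisym[of a m] by blast
    then have "m \<notin> keys (g a)" using g(2)[of a] a unfolding is_initial_monom_def by blast
    then show ?thesis by (simp add: in_keys_iff)
  qed simp
  then have "(\<Sum>a\<in>X - T - {m}. lookup (Const (c a) * g a) m) = 0"
    by (intro sum.neutral ballI)
  then have "lookup (\<Sum>m\<in>X - T. Const (c m) * g m) m = c m * lookup (g m) m"
    unfolding lookup_sum
    using sum.remove[OF \<open>finite (X - T)\<close> m(1), of "\<lambda>a. lookup (Const (c a) * g a) m"] by simp
  moreover have "lookup (\<Sum>m\<in>X - T. Const (c m) * g m) m = 0"
    using c(2) m(1) unfolding Z_def by blast
  ultimately have "lookup (g m) m = 0" using m(2) by simp
  then show False using g(2)[OF m(1)] by (simp add: is_initial_monom_def in_keys_iff)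
qed

lemma initial_degree_eq:
  assumes "i \<in> K"
  shows "initial_degree (P $ i) = d"
  unfolding initial_degree_def
proof (rule Min_eqI)
  show "d \<le> y" if "y \<in> mdeg ` keys (P $ i)" for y
    using that initial_order_ge[OF assms] by (auto simp: weighted_def mdeg_wdeg)
  show "d \<in> mdeg ` keys (P $ i)" using exists_degree_d[OF assms] by auto
qed simp

end

section \<open>Leading parts under substitution\<close>

definition weight_cong :: "('n::finite \<Rightarrow> nat) \<Rightarrow> nat \<Rightarrow> 'n mpoly \<Rightarrow> 'n mpoly \<Rightarrow> bool"
  where "weight_cong w N a b \<longleftrightarrow> a \<in> weighted w N \<and> b \<in> weighted w N \<and> a - b \<in> weighted w (Suc N)"

text \<open>The difference of the products is \<open>a * (a' - b') + (a - b) * b'\<close>; the lower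
  weight bounds on \<open>a\<close> and \<open>b'\<close> raise both summands above
  \<open>N + N'\<close>.\<close>

lemma weight_cong_mult:
  assumes "weight_cong w N a b" "weight_cong w N' a' b'"
  shows "weight_cong w (N + N') (a * a') (b * b')"
proof -
  have "a * a' - b * b' = a * (a' - b') + (a - b) * b'" by (simp add: algebra_simps)
  moreover have "a * (a' - b') \<in> weighted w (N + Suc N')" "(a - b) * b' \<in> weighted w (Suc N + N')"
    using assms unfolding weight_cong_def by (blast intro: weighted_mult)+
  ultimately have "a * a' - b * b' \<in> weighted w (Suc (N + N'))"
    by (simp add: weighted_add)
  then show ?thesis using assms by (auto simp: weight_cong_def intro: weighted_mult)
qed

lemma weight_cong_1: "weight_cong w 0 1 1"
  by (simp add: weight_cong_def)

lemma weight_cong_power: "weight_cong w N a b \<Longrightarrow> weight_cong w (N * k) (a ^ k) (b ^ k)"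
  by (induction k) (auto simp: weight_cong_1 dest: weight_cong_mult)

lemma weight_cong_prod:
  "finite A \<Longrightarrow> (\<And>i. i \<in> A \<Longrightarrow> weight_cong w (u i) (f i) (g i)) \<Longrightarrow>
    weight_cong w (sum u A) (prod f A) (prod g A)"
  by (induction A rule: finite_induct) (auto simp: weight_cong_1 intro: weight_cong_mult)

lemma psubst_weight_cong:
  assumes "\<And>i. weight_cong w 1 (L $ i) (M $ i)" "p \<in> order_ge d"
  shows "psubst p L - psubst p M \<in> weighted w (Suc d)"
proof -
  have "psubst p L - psubst p M = (\<Sum>m\<in>keys p. Const (lookup p m) *
      ((\<Prod>i\<in>UNIV. (L $ i) ^ lookup m i) - (\<Prod>i\<in>UNIV. (M $ i) ^ lookup m i)))"
    by (simp add: psubst_def right_diff_distrib sum_subtractf)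
  also have "\<dots> \<in> weighted w (Suc d)"
  proof (intro weighted_sum weighted_mult_left)
    fix m assume "m \<in> keys p"
    then have "d \<le> mdeg m" using assms(2) by (auto simp: weighted_def mdeg_wdeg)
    have "weight_cong w (\<Sum>i\<in>UNIV. 1 * lookup m i) (\<Prod>i\<in>UNIV. (L $ i) ^ lookup m i)
        (\<Prod>i\<in>UNIV. (M $ i) ^ lookup m i)"
      by (intro weight_cong_prod weight_cong_power assms(1)) auto
    then have "(\<Prod>i\<in>UNIV. (L $ i) ^ lookup m i) - (\<Prod>i\<in>UNIV. (M $ i) ^ lookup m i) \<in> weighted w (Suc (mdeg m))"
      by (simp add: weight_cong_def mdeg_def)
    then show "(\<Prod>i\<in>UNIV. (L $ i) ^ lookup m i) - (\<Prod>i\<in>UNIV. (M $ i) ^ lookup m i) \<in> weighted w (Suc d)"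
      by (rule weighted_mono) (simp add: \<open>d \<le> mdeg m\<close>)
  qed
  finally show ?thesis .
qed

lemma lookup_sum_singles:
  "lookup (\<Sum>m | m \<in> keys p \<and> Q m. single m (lookup p m)) a = (if Q a then lookup p a else 0)"
proof -
  have "lookup (\<Sum>m | m \<in> keys p \<and> Q m. single m (lookup p m)) a =
    (\<Sum>m | m \<in> keys p \<and> Q m. if m = a then lookup p m else 0)"
    by (auto simp: lookup_sum lookup_single when_def intro: sum.cong)
  also have "\<dots> = (if Q a then lookup p a else 0)"
    by (subst sum.delta) (auto simp: in_keys_iff)
  finally show ?thesis .
qed

lemma lookup_initial_form:
  "lookup (initial_form p) m = (if mdeg m = initial_degree p then lookup p m else 0)"
  unfolding initial_form_def by (rule lookup_sum_singles)

text \<open>Restriction of a homogeneous polynomial to the line through \<open>c\<close>, with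
  \<open>Var i0\<close> as parameter.\<close>

lemma psubst_line:
  assumes "\<And>m. m \<in> keys f \<Longrightarrow> mdeg m = d"
  shows "psubst f (\<chi> i. Const (c $ i) * Var i0) = Const (peval f c) * Var i0 ^ d"
proof -
  have 1: "(\<Prod>i\<in>UNIV. (Const (c $ i) * Var i0) ^ lookup m i) =
      Const (\<Prod>i\<in>UNIV. (c $ i) ^ lookup m i) * Var i0 ^ d" if "m \<in> keys f" for m
  proof -
    have E: "(\<Prod>i\<in>UNIV. Var i0 ^ lookup m i) = Var i0 ^ d"
      unfolding assms[OF that, symmetric] mdeg_def by (rule power_sum[symmetric])
    show ?thesis unfolding power_mult_distrib prod.distrib Const_power Const_prod E ..
  qed
  show ?thesis
    unfolding psubst_def peval_def Const_sum sum_distrib_right vec_lambda_beta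
    by (rule sum.cong) (simp_all only: 1 Const_mult mult.assoc)
qed

context normal_system
begin

text \<open>A common zero of the initial forms is moved to a coordinate axis, where the counting argument
  applies.\<close>
lemma initial_forms_no_common_zero:
  assumes c: "\<And>j. j \<notin> K \<Longrightarrow> c $ j = 0" "c \<noteq> 0"
    and zero: "\<And>i. i \<in> K \<Longrightarrow> peval (initial_form (P $ i)) c = 0"
  shows False
proof -
  obtain i0 where i0: "c $ i0 \<noteq> 0" using c(2) by (auto simp: vec_eq_iff)
  then have "i0 \<in> K" using c(1) by blast
  then have d: "2 \<le> d" using two_le_d by blast
  \<comment> \<open>An invertible linear change taking the unit vector of \<open>i0\<close> to
    \<open>c\<close>. It leaves the variables outside \<open>K\<close> alone because
    \<open>c\<close> vanishes there.\<close>
  define L :: "'n system" where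
    "L = (\<chi> i. if i = i0 then Const (c $ i0) * Var i0 else Var i + Const (c $ i) * Var i0)"
  define L' :: "'n system" where
    "L' = (\<chi> i. if i = i0 then Const (1 / c $ i0) * Var i0 else Var i - Const (c $ i / c $ i0) * Var i0)"
  define Q where "Q = sys_comp P L"
  have LL': "sys_comp L L' = sys_id" "sys_comp L' L = sys_id"
    using i0 by (auto simp: vec_eq_iff L_def L'_def sys_id_def psubst_simps mult.assoc[symmetric] Const_mult[symmetric])
  have "equivalent_at 0 P Q L L' (mat 1) (mat 1)"
    by (simp add: equivalent_at_def LL' Q_def) (simp add: vec_eq_iff L_def peval_simps)
  then have "card (std_below le (sys_ideal Q) M) = card (std_below le (sys_ideal P) M)" for M
    by (rule equivalent_at_0_card_std_below)
  then have card: "card (std_below le (sys_ideal Q) M) \<le> d ^ card K" for M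
    using card_std_below_le_power[OF hilbert] by simp
  have Lw: "L $ i \<in> weighted w (w i)" if "w i0 = 1" "\<And>i. 1 \<le> w i" "\<And>i. i \<in> K \<Longrightarrow> w i = 1" for w i
  proof -
    have "L $ i = (if i \<in> K then L $ i else Var i)" using c(1) \<open>i0 \<in> K\<close> by (auto simp: L_def)
    moreover have "L $ i \<in> weighted w 1"
      unfolding L_def using weighted_mono[OF weighted_Var[of i w], of 1] weighted_Var[of i0 w] that(1,2)
      by (auto intro!: weighted_mult_left weighted_add)
    ultimately show ?thesis using that(3) weighted_Var[of i w] by (metis)
  qed
  have Qw: "Q $ i \<in> weighted (\<lambda>i. if i \<in> K then 1 else d) d" for i
    unfolding Q_def sys_comp_nth
    by (rule psubst_weighted[OF Lw weighted_generators]) (use \<open>i0 \<in> K\<close> d in auto)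
  define v where "v i = (if i = i0 then 1 else if i \<in> K then 2 else d + 1)" for i
  have Qv: "Q $ i \<in> weighted v (d + 1)" for i
  proof -
    \<comment> \<open>The only part of \<open>P $ i\<close> that could produce the forbidden power
      \<open>Var i0 ^ d\<close>: it is the initial form for \<open>i \<in> K\<close> and zero
      otherwise. Modulo terms of second weight at least 2, \<open>L\<close> is the line
      \<open>M\<close>, so the coefficient of that power is \<open>peval f c\<close>.\<close>
    define f where "f = (\<Sum>m | m \<in> keys (P $ i) \<and> keys m \<subseteq> K \<and> mdeg m = d. single m (lookup (P $ i) m))"
    define M :: "'n system" where "M = (\<chi> i. Const (c $ i) * Var i0)"
    have f: "lookup f m = (if keys m \<subseteq> K \<and> mdeg m = d then lookup (P $ i) m else 0)" for m
      unfolding f_def by (rule lookup_sum_singles)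
    then have fd: "mdeg m = d" if "m \<in> keys f" for m
      using that by (auto simp: in_keys_iff split: if_splits)
    have "peval f c = 0"
    proof (cases "i \<in> K")
      case True
      have "f = initial_form (P $ i)"
        by (rule poly_mapping_eqI)
          (use nfD(4)[OF True] in \<open>auto simp: f lookup_initial_form initial_degree_eq[OF True] in_keys_iff\<close>)
      then show ?thesis using zero[OF True] by simp
    next
      case False
      have "f = 0"
        by (rule poly_mapping_eqI) (use nfD(3)[OF False] in \<open>auto simp: f in_keys_iff split: if_splits\<close>)
      then show ?thesis by simp
    qed
    then have "psubst f M = 0" using psubst_line[OF fd] by (simp add: M_def)
    moreover have "psubst f L - psubst f M \<in> weighted v (Suc d)"
    proof (rule psubst_weight_cong)
      show "f \<in> order_ge d" using fd by (auto simp: weighted_def mdeg_wdeg)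
      fix l
      have v: "1 \<le> v l" "l \<noteq> i0 \<Longrightarrow> 2 \<le> v l" "v i0 = 1" using d by (auto simp: v_def)
      have 1: "Var l \<in> weighted v 1" "Var i0 \<in> weighted v 1"
        using weighted_mono[OF weighted_Var[of l v] v(1)] weighted_Var[of i0 v] v(3) by auto
      have 2: "Var l \<in> weighted v 2" if "l \<noteq> i0"
        using weighted_mono[OF weighted_Var[of l v] v(2)[OF that]] .
      have "M $ l \<in> weighted v 1" "L $ l \<in> weighted v 1"
        using 1 by (auto simp: M_def L_def intro!: weighted_mult_left weighted_add)
      moreover have "L $ l - M $ l \<in> weighted v 2"
        using 2 by (simp add: M_def L_def)
      ultimately show "weight_cong v 1 (L $ l) (M $ l)"
        by (simp add: weight_cong_def numeral_2_eq_2)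
    qed
    ultimately have "psubst f L \<in> weighted v (Suc d)" by simp
    \<comment> \<open>The rest has degree at least \<open>d + 1\<close> or contains a variable
      outside \<open>K\<close>, whose weight is already \<open>d + 1\<close>.\<close>
    moreover have "psubst (P $ i - f) L \<in> weighted v (d + 1)"
    proof (rule psubst_weighted)
      let ?u = "\<lambda>i. if i \<in> K then 1 else d + 1"
      show "P $ i - f \<in> weighted ?u (d + 1)"
      proof (rule weighted_if_supported)
        fix m assume m: "m \<in> keys (P $ i - f)" "keys m \<subseteq> K"
        then have key: "m \<in> keys (P $ i)" and "mdeg m \<noteq> d"
          by (auto simp: in_keys_iff lookup_minus f split: if_splits)
        have "d \<le> mdeg m"
          using initial_order_ge[of i] nfD(3)[of i m] key m(2)
          by (cases "i \<in> K") (auto simp: weighted_def mdeg_wdeg)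
        then show "d + 1 \<le> mdeg m" using \<open>mdeg m \<noteq> d\<close> by simp
      qed
      fix l
      show "L $ l \<in> weighted v (?u l)"
      proof (cases "l \<in> K")
        case True
        have "1 \<le> v l" "v i0 = 1" by (auto simp: v_def)
        then have "Var l \<in> weighted v 1" "Var i0 \<in> weighted v 1"
          using weighted_mono[OF weighted_Var[of l v]] weighted_Var[of i0 v] by auto
        then show ?thesis
          using True by (auto simp: L_def intro!: weighted_mult_left weighted_add)
      next
        case False
        then have "L $ l = Var l" "v l = d + 1" using c(1) \<open>i0 \<in> K\<close> by (auto simp: L_def v_def)
        then show ?thesis using False weighted_Var[of l v] by simp
      qed
    qed
    ultimately have "psubst f L + psubst (P $ i - f) L \<in> weighted v (d + 1)"
      by (simp add: weighted_add)
    then show ?thesis by (simp add: Q_def psubst_diff)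
  qed
  show False
  proof (rule no_tangent_direction)
    show "i0 \<in> K" by fact
    show "1 \<le> d" using d by simp
    show "Q $ i \<in> weighted (\<lambda>i. if i \<in> K then 1 else d) d" for i by (rule Qw)
    show "Q $ i \<in> weighted (\<lambda>i. if i = i0 then 1 else if i \<in> K then 2 else d + 1) (d + 1)" for i
      using Qv unfolding v_def .
    show "card (std_below le (sys_ideal Q) M) \<le> d ^ card K" for M by (rule card)
  qed
qed

lemma initial_form_Var:
  assumes "j \<notin> K"
  shows "initial_form (P $ j) = Var j"
proof -
  have nf': "lookup (P $ j) m = lookup (Var j) m" if "mdeg m < 2" for m
    using nfD(2)[OF assms] that by (simp add: weighted_iff mdeg_wdeg lookup_minus)
  have key: "single j 1 \<in> keys (P $ j)"
    using normal_form_keys_Var(1)[OF nf assms] by (simp add: in_keys_iff)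
  have deg: "1 \<le> mdeg m" if "m \<in> keys (P $ j)" for m
    using normal_form_keys_Var(2)[OF nf assms that] by (cases "m = single j 1") auto
  have "initial_degree (P $ j) = 1"
    unfolding initial_degree_def
  proof (rule Min_eqI)
    show "1 \<in> mdeg ` keys (P $ j)" using key by force
  qed (use deg in auto)
  then show ?thesis
    by (intro poly_mapping_eqI) (auto simp: lookup_initial_form nf' Var_def lookup_single when_def)
qed

end

section \<open>Reduction to normal form\<close>

lemma normal_form_mono:
  "normal_form K k l P \<Longrightarrow> k' \<le> k \<Longrightarrow> l' \<le> l \<Longrightarrow> normal_form K k' l' P"
  unfolding normal_form_def by (meson le_less_trans)

lemma psubst_supported:
  assumes "\<And>m. m \<in> keys p \<Longrightarrow> keys m \<subseteq> K" "\<And>i. i \<in> K \<Longrightarrow> \<Phi> $ i = Var i"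
  shows "psubst p \<Phi> = p"
proof -
  have "(\<Prod>i\<in>UNIV. (\<Phi> $ i) ^ lookup m i) = (\<Prod>i\<in>UNIV. Var i ^ lookup m i)" if "m \<in> keys p" for m
  proof (rule prod.cong[OF refl])
    fix i
    show "(\<Phi> $ i) ^ lookup m i = Var i ^ lookup m i"
    proof (cases "i \<in> K")
      case False
      then have "i \<notin> keys m" using assms(1)[OF that] by blast
      then show ?thesis by (simp add: in_keys_iff)
    qed (simp add: assms(2))
  qed
  then have "psubst p \<Phi> = (\<Sum>m\<in>keys p. single m (lookup p m))"
    unfolding psubst_def by (intro sum.cong) (simp_all add: single_eq_prod_Var[symmetric])
  then show ?thesis by (simp add: poly_mapping_sum_singles)
qed

text \<open>The shear subtracts from each variable outside \<open>K\<close> the unwanted part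
  \<open>c j\<close> of degree \<open>l + 1\<close>. The linear term of \<open>P $ j\<close> then
  cancels it, and all new terms on \<open>K\<close> have higher degree. As \<open>c j\<close>
  involves only fixed variables, adding it back is the inverse.\<close>

lemma normal_form_raise_second:
  assumes nf: "normal_form K 1 l P" and l: "1 \<le> l"
  shows "\<exists>Q \<Phi> \<Psi> U V. equivalent_at 0 P Q \<Phi> \<Psi> U V \<and> normal_form K 1 (Suc l) Q"
proof -
  define c where "c j = (\<Sum>m | m \<in> keys (P $ j) \<and> keys m \<subseteq> K \<and> mdeg m = Suc l. single m (lookup (P $ j) m))" for j
  define \<Phi> where "\<Phi> = (\<chi> i. if i \<in> K then Var i else Var i - c i)"
  define \<Psi> where "\<Psi> = (\<chi> i. if i \<in> K then Var i else Var i + c i)"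
  define Q where "Q = sys_comp P \<Phi>"
  have c: "lookup (c j) m = (if keys m \<subseteq> K \<and> mdeg m = Suc l then lookup (P $ j) m else 0)" for j m
    unfolding c_def by (rule lookup_sum_singles)
  have keys_c: "keys m \<subseteq> K" "mdeg m = Suc l" if "m \<in> keys (c j)" for j m
    using that by (auto simp: in_keys_iff c split: if_splits)
  have c_fix: "psubst (c j) \<Phi> = c j" "psubst (c j) \<Psi> = c j" for j
    by (auto intro!: psubst_supported[where K = K] dest: keys_c(1) simp: \<Phi>_def \<Psi>_def)
  have c_ord: "c j \<in> order_ge (Suc l)" for j
    using keys_c(2) by (auto simp: weighted_def mdeg_wdeg)
  have inverse: "sys_comp \<Phi> \<Psi> = sys_id" "sys_comp \<Psi> \<Phi> = sys_id"
    by (auto simp: vec_eq_iff \<Phi>_def \<Psi>_def sys_id_def psubst_simps c_fix[unfolded \<Phi>_def \<Psi>_def])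
  have \<Phi>1: "\<Phi> $ i \<in> order_ge (Suc 0)" for i
    using weighted_Var[of i "\<lambda>_. Suc 0"] weighted_mono[OF c_ord, of "Suc 0" i]
    by (auto simp: \<Phi>_def intro: weighted_diff)
  then have "sys_eval \<Phi> 0 = 0"
    by (simp add: vec_eq_iff peval_at_0 order_ge_1_iff[symmetric])
  then have equiv: "equivalent_at 0 P Q \<Phi> \<Psi> (mat 1) (mat 1)"
    by (simp add: equivalent_at_def inverse Q_def)
  have P2: "i \<in> K \<Longrightarrow> P $ i \<in> order_ge 2" "j \<notin> K \<Longrightarrow> P $ j - Var j \<in> order_ge 2" for i j
    using nf by (auto simp: normal_form_def)
  have subst2: "psubst p \<Phi> \<in> order_ge 2" if "p \<in> order_ge 2" for p
    by (rule psubst_weighted[OF _ that]) (rule \<Phi>1)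
  have Q2: "Q $ i \<in> order_ge 2" if "i \<in> K" for i
    using subst2[OF P2(1)[OF that]] by (simp add: Q_def)
  have Q2': "Q $ j - Var j \<in> order_ge 2" if j: "j \<notin> K" for j
  proof -
    have "Q $ j - Var j = psubst (P $ j - Var j) \<Phi> - c j"
      using j by (simp add: Q_def psubst_diff \<Phi>_def)
    moreover have "c j \<in> order_ge 2" using weighted_mono[OF c_ord] l by simp
    ultimately show ?thesis using weighted_diff[OF subst2[OF P2(2)[OF j]]] by simp
  qed
  have third: "Suc l < mdeg m" if j: "j \<notin> K" and m: "m \<in> keys (Q $ j)" "keys m \<subseteq> K" for j m
  proof -
    \<comment> \<open>In \<open>?w\<close> a monomial on \<open>K\<close> weighs its degree, and
      \<open>Var j\<close> already weighs \<open>l + 2\<close>. In \<open>?u\<close> a term of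
      \<open>r\<close> either has degree at least \<open>l + 2\<close> or has degree at least 2 and
      gains \<open>l\<close> from a variable outside \<open>K\<close>; a substituted
      \<open>\<Phi> $ i\<close> outside \<open>K\<close> indeed has \<open>?w\<close>-weight at
      least \<open>l + 1\<close>.\<close>
    let ?u = "\<lambda>i. 1 + (if i \<in> K then 0 else l)" and ?w = "\<lambda>i. if i \<in> K then 1 else l + 2"
    define r where "r = P $ j - Var j - c j"
    have "r \<in> weighted ?u (l + 2)"
      unfolding weighted_def
    proof safe
      fix a assume a: "a \<in> keys r"
      have u: "wdeg ?u a = mdeg a + wdeg (\<lambda>i. if i \<in> K then 0 else l) a"
        by (simp only: wdeg_def mdeg_def ring_distribs sum.distrib mult_1)
      show "l + 2 \<le> wdeg ?u a"
      proof (cases "keys a \<subseteq> K")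
        case True
        then have "lookup (Var j) a = 0" using j by (auto simp: Var_def lookup_single when_def)
        then have "a \<in> keys (P $ j)" "mdeg a \<noteq> Suc l"
          using a True by (auto simp: r_def in_keys_iff lookup_minus c split: if_splits)
        then have "l < mdeg a" "mdeg a \<noteq> Suc l" using nf j True by (auto simp: normal_form_def)
        then show ?thesis using u by simp
      next
        case False
        then have "a \<in> keys (P $ j - Var j)"
          using a by (auto simp: r_def in_keys_iff lookup_minus c)
        then have "2 \<le> mdeg a" using P2(2)[OF j] by (auto simp: weighted_def mdeg_wdeg)
        moreover obtain i where "i \<in> keys a" "i \<notin> K" using False by blast
        then have "l \<le> wdeg (\<lambda>i. if i \<in> K then 0 else l) a"
          using wdeg_ge_weight[of i a "\<lambda>i. if i \<in> K then 0 else l"] by simp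
        ultimately show ?thesis using u by simp
      qed
    qed
    moreover have "\<Phi> $ i \<in> weighted ?w (?u i)" for i
    proof (cases "i \<in> K")
      case True
      then show ?thesis using weighted_Var[of i ?w] by (simp add: \<Phi>_def)
    next
      case False
      have "c i \<in> weighted ?w (1 + l)"
        unfolding weighted_def
      proof safe
        fix a assume "a \<in> keys (c i)"
        then have "wdeg ?w a = Suc l" using wdeg_supported[of a K ?w] keys_c by simp
        then show "1 + l \<le> wdeg ?w a" by simp
      qed
      moreover have "Var i \<in> weighted ?w (1 + l)"
        using weighted_mono[OF weighted_Var[of i ?w]] False by simp
      ultimately show ?thesis using False by (simp add: \<Phi>_def weighted_diff)
    qed
    ultimately have "psubst r \<Phi> \<in> weighted ?w (l + 2)"
      by (rule psubst_weighted[rotated])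
    moreover have "Var j \<in> weighted ?w (l + 2)" using weighted_Var[of j ?w] j by simp
    ultimately have "psubst r \<Phi> + Var j \<in> weighted ?w (l + 2)" by (rule weighted_add)
    moreover have "Q $ j = psubst r \<Phi> + Var j"
      using j by (simp add: Q_def r_def psubst_diff c_fix) (simp add: \<Phi>_def)
    ultimately have "l + 2 \<le> wdeg ?w m" using m(1) by (auto simp: weighted_def)
    then show ?thesis using m(2) by (simp add: wdeg_supported)
  qed
  have "1 < mdeg m" if "i \<in> K" "m \<in> keys (Q $ i)" for i m
    using Q2[OF that(1)] that(2) by (auto simp: weighted_def mdeg_wdeg)
  then have "normal_form K 1 (Suc l) Q"
    unfolding normal_form_def using Q2 Q2' third by blast
  then show ?thesis using equiv by blast
qed

text \<open>Rows in \<open>K\<close> and columns outside \<open>K\<close> make the square of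
  \<open>N\<close> vanish.\<close>

lemma block_unipotent_inverse:
  fixes N :: "'a::comm_ring_1^'n::finite^'n"
  assumes "\<And>i j. N $ i $ j \<noteq> 0 \<Longrightarrow> i \<in> K \<and> j \<notin> K"
  shows "(mat 1 - N) ** (mat 1 + N) = mat 1" "(mat 1 + N) ** (mat 1 - N) = mat 1"
proof -
  have "N $ i $ l * N $ l $ j = 0" for i j l
    using assms[of i l] assms[of l j] by (cases "N $ i $ l = 0"; cases "N $ l $ j = 0") simp_all
  then have "N ** N = 0"
    by (simp add: vec_eq_iff matrix_matrix_mult_def)
  have l: "(A - B) ** C = A ** C - B ** C" "(A + B) ** C = A ** C + B ** C"
    "C ** (A - B) = C ** A - C ** B" for A B C :: "'a^'n^'n"
    by (simp_all add: vec_eq_iff matrix_matrix_mult_def ring_distribs sum.distrib sum_subtractf)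
  show "(mat 1 - N) ** (mat 1 + N) = mat 1" "(mat 1 + N) ** (mat 1 - N) = mat 1"
    by (simp_all add: l matrix_add_ldistrib \<open>N ** N = 0\<close>)
qed

text \<open>An unwanted term of degree \<open>k + 1\<close> is a term of degree \<open>k\<close>
  times some \<open>Var j\<close> with \<open>j \<notin> K\<close>. Subtracting the same multiple of
  \<open>P $ j\<close> removes it at the cost of terms of order \<open>k + 2\<close>. Only the rows
  in \<open>K\<close> change, so the bound \<open>l\<close> survives.\<close>

lemma normal_form_raise_first:
  assumes nf: "normal_form K k l P" and k: "1 \<le> k"
  shows "\<exists>Q \<Phi> \<Psi> U V. equivalent_at 0 P Q \<Phi> \<Psi> U V \<and> normal_form K (Suc k) l Q"
proof -
  \<comment> \<open>One variable outside \<open>K\<close> is chosen per monomial, so that each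
    unwanted term is assigned to a single column and is subtracted once.\<close>
  define s where "s m = (SOME j. j \<in> keys m \<and> j \<notin> K)" for m :: "'a monom"
  define M where "M i = {m \<in> keys (P $ i). \<not> keys m \<subseteq> K \<and> mdeg m = Suc k}" for i
  define b where "b i j = (\<Sum>m\<in>{m \<in> M i. s m = j}. single (m - single j 1) (lookup (P $ i) m))" for i j
  define N :: "'a pmatrix" where "N = (\<chi> i j. if i \<in> K \<and> j \<notin> K then b i j else 0)"
  define Q where "Q = (mat 1 - N) *v P"
  have s: "s m \<in> keys m" "s m \<notin> K" if "m \<in> M i" for m i
  proof -
    have "\<exists>j. j \<in> keys m \<and> j \<notin> K" using that by (auto simp: M_def)
    from someI_ex[OF this] show "s m \<in> keys m" "s m \<notin> K" by (auto simp: s_def)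
  qed
  have split: "(m - single (s m) 1) + single (s m) 1 = m" if "m \<in> M i" for m i
    by (rule poly_mapping_eqI)
      (use s[OF that] in \<open>auto simp: lookup_add lookup_minus lookup_single when_def in_keys_iff\<close>)
  have b_ord: "b i j \<in> order_ge k" for i j
    unfolding b_def
  proof (intro weighted_sum weighted_single impI)
    fix m assume m: "m \<in> {m \<in> M i. s m = j}"
    then have "mdeg m = mdeg (m - single j 1) + 1" using split[of m i] by (metis (mono_tags) mem_Collect_eq mdeg_add mdeg_single)
    then show "k \<le> wdeg (\<lambda>_. Suc 0) (m - single j 1)" using m by (simp add: M_def mdeg_wdeg)
  qed
  have N_ord: "N $ i $ j \<in> order_ge k" for i j
    using b_ord by (simp add: N_def)
  have Q: "Q $ i = P $ i - (\<Sum>j\<in>UNIV. N $ i $ j * P $ j)" for i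
  proof -
    have "(mat 1 *v P) $ i = P $ i" by simp
    then show ?thesis
      by (simp add: Q_def matrix_vector_mult_def left_diff_distrib sum_subtractf)
  qed
  have "equivalent_at 0 P Q sys_id sys_id (mat 1 - N) (mat 1 + N)"
  proof -
    have "i \<in> K \<and> j \<notin> K" if "N $ i $ j \<noteq> 0" for i j
      using that by (simp add: N_def split: if_splits)
    from block_unipotent_inverse[of N K, OF this] show ?thesis
      by (simp add: equivalent_at_def Q_def)
  qed
  moreover have "normal_form K (Suc k) l Q"
  proof -
    have QK: "Q $ j = P $ j" if "j \<notin> K" for j
      using that by (simp add: Q N_def)
    have P2: "P $ j - Var j \<in> order_ge 2" if "j \<notin> K" for j
      using nf that by (simp add: normal_form_def)
    have P1: "P $ j \<in> order_ge (Suc 0)" if "j \<notin> K" for j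
      using weighted_add[OF weighted_mono[OF P2[OF that], of "Suc 0"] weighted_Var[of j "\<lambda>_. Suc 0"]] by simp
    have Q2: "Q $ i \<in> order_ge 2" if "i \<in> K" for i
      unfolding Q
    proof (intro weighted_diff weighted_sum)
      show "P $ i \<in> order_ge 2" using nf that by (simp add: normal_form_def)
      fix j
      show "N $ i $ j * P $ j \<in> order_ge 2"
      proof (cases "j \<in> K")
        case False
        show ?thesis
          by (rule weighted_mono[OF weighted_mult[OF N_ord P1[OF False]]]) (use k in simp)
      qed (simp add: N_def)
    qed
    have "Suc k < mdeg m" if i: "i \<in> K" and m: "m \<in> keys (Q $ i)" "\<not> keys m \<subseteq> K" for i m
    proof (rule ccontr)
      assume "\<not> Suc k < mdeg m"
      then have deg: "mdeg m \<le> Suc k" by simp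
      have Y: "(\<Sum>j\<in>UNIV. N $ i $ j * Var j) = (\<Sum>m\<in>M i. single m (lookup (P $ i) m))"
      proof -
        have "N $ i $ j * Var j = (\<Sum>m\<in>{m \<in> M i. s m = j}. single m (lookup (P $ i) m))" for j
        proof (cases "j \<in> K")
          case True
          then have "{m \<in> M i. s m = j} = {}" using s by auto
          then show ?thesis using True by (simp only: N_def) simp
        next
          case False
          have "b i j * Var j = (\<Sum>m\<in>{m \<in> M i. s m = j}. single m (lookup (P $ i) m))"
            unfolding b_def Var_def sum_distrib_right mult_single
            by (rule sum.cong) (use split in auto)
          then show ?thesis using False i by (simp add: N_def)
        qed
        then have "(\<Sum>j\<in>UNIV. N $ i $ j * Var j) =
            (\<Sum>j\<in>UNIV. \<Sum>m\<in>{m \<in> M i. s m = j}. single m (lookup (P $ i) m))"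
          by (intro sum.cong refl)
        also have "\<dots> = (\<Sum>m\<in>M i. single m (lookup (P $ i) m))"
          by (rule sum.group) (simp_all add: M_def)
        finally show ?thesis .
      qed
      have rest: "(\<Sum>j\<in>UNIV. N $ i $ j * (P $ j - Var j)) \<in> order_ge (k + 2)"
      proof (rule weighted_sum)
        fix j
        show "N $ i $ j * (P $ j - Var j) \<in> order_ge (k + 2)"
        proof (cases "j \<in> K")
          case False
          show ?thesis by (rule weighted_mult[OF N_ord P2[OF False]])
        qed (simp add: N_def)
      qed
      have "Q $ i = P $ i - (\<Sum>m\<in>M i. single m (lookup (P $ i) m)) - (\<Sum>j\<in>UNIV. N $ i $ j * (P $ j - Var j))"
        unfolding Q Y[symmetric] by (simp add: right_diff_distrib sum_subtractf)
      moreover have "lookup (\<Sum>j\<in>UNIV. N $ i $ j * (P $ j - Var j)) m = 0"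
        using rest deg by (simp add: weighted_iff mdeg_wdeg)
      moreover have "lookup (\<Sum>m\<in>M i. single m (lookup (P $ i) m)) m =
          (if \<not> keys m \<subseteq> K \<and> mdeg m = Suc k then lookup (P $ i) m else 0)"
        unfolding M_def using lookup_sum_singles[of "P $ i" "\<lambda>m. \<not> keys m \<subseteq> K \<and> mdeg m = Suc k"] .
      ultimately have "lookup (P $ i) m \<noteq> 0" "mdeg m \<noteq> Suc k"
        using m by (auto simp: in_keys_iff lookup_minus split: if_splits)
      moreover have "k < mdeg m" using nf i m(2) calculation(1) by (auto simp: normal_form_def in_keys_iff)
      ultimately show False using deg by simp
    qed
    then show ?thesis
      using Q2 QK nf unfolding normal_form_def by auto
  qed
  ultimately show ?thesis by blast
qed

lemma equivalent_at_refl: "equivalent_at 0 P P sys_id sys_id (mat 1) (mat 1)"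
  by (simp add: equivalent_at_def)

text \<open>The second bound is raised first, then the first bound, whose steps keep the second.
  Both bounds are taken to \<open>d + 1\<close>, and monotonicity brings them back to
  \<open>d\<close>, which covers \<open>d = 0\<close>.\<close>

lemma exists_normal_form:
  assumes "normal_form K 1 1 P"
  shows "\<exists>Q \<Phi> \<Psi> U V. equivalent_at 0 P Q \<Phi> \<Psi> U V \<and> normal_form K d d Q"
proof -
  have 1: "\<exists>Q \<Phi> \<Psi> U V. equivalent_at 0 P Q \<Phi> \<Psi> U V \<and> normal_form K 1 (Suc l) Q" for l
  proof (induction l)
    case 0
    then show ?case using assms equivalent_at_refl by (metis One_nat_def)
  next
    case (Suc l)
    then obtain Q \<Phi> \<Psi> U V where Q: "equivalent_at 0 P Q \<Phi> \<Psi> U V" "normal_form K 1 (Suc l) Q" by blast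
    obtain Q' \<Phi>' \<Psi>' U' V' where "equivalent_at 0 Q Q' \<Phi>' \<Psi>' U' V'" "normal_form K 1 (Suc (Suc l)) Q'"
      using normal_form_raise_second[OF Q(2)] by auto
    then show ?case using equivalent_at_trans[OF Q(1)] by blast
  qed
  have 2: "\<exists>Q \<Phi> \<Psi> U V. equivalent_at 0 P Q \<Phi> \<Psi> U V \<and> normal_form K (Suc k) (Suc d) Q" for k
  proof (induction k)
    case 0
    then show ?case using 1[of d] by simp
  next
    case (Suc k)
    then obtain Q \<Phi> \<Psi> U V where Q: "equivalent_at 0 P Q \<Phi> \<Psi> U V" "normal_form K (Suc k) (Suc d) Q" by blast
    obtain Q' \<Phi>' \<Psi>' U' V' where "equivalent_at 0 Q Q' \<Phi>' \<Psi>' U' V'" "normal_form K (Suc (Suc k)) (Suc d) Q'"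
      using normal_form_raise_first[OF Q(2)] by auto
    then show ?case using equivalent_at_trans[OF Q(1)] by blast
  qed
  obtain Q \<Phi> \<Psi> U V where Q: "equivalent_at 0 P Q \<Phi> \<Psi> U V" "normal_form K (Suc d) (Suc d) Q"
    using 2[of d] by blast
  then have "normal_form K d d Q" using normal_form_mono by fastforce
  then show ?thesis using Q(1) by blast
qed

section \<open>Rank normal form of a matrix with prescribed kernel coordinates\<close>

lemma matrix_vector_axis: "(A *v axis j 1) $ i = (A $ i $ j :: 'a::comm_ring_1)"
  by (simp add: matrix_vector_mult_def axis_def if_distrib cong: if_cong)

text \<open>The given columns are extended to a basis, whose remaining vectors fill the remaining
  columns.\<close>

lemma exists_invertible_with_columns:
  fixes u :: "'n::finite \<Rightarrow> 'a::field^'n"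
  assumes "inj_on u T" "vec.independent (u ` T)"
  shows "\<exists>A. invertible A \<and> (\<forall>j\<in>T. A *v axis j 1 = u j)"
proof -
  let ?B = "vec.extend_basis (u ` T)"
  have sup: "u ` T \<subseteq> ?B" and ind: "vec.independent ?B" and span: "vec.span ?B = UNIV"
    using vec.extend_basis_superset vec.independent_extend_basis vec.span_extend_basis assms(2) by blast+
  have fin: "finite ?B" using ind by (rule vec.finiteI_independent)
  have "card ?B = vec.dim (vec.span ?B)"
    by (simp only: vec.dim_span vec.dim_eq_card_independent[OF ind])
  also have "\<dots> = CARD('n)"
    unfolding span by (rule vec_dim_card)
  finally have "card (- T) = card (?B - u ` T)"
    using card_Diff_subset[OF finite_subset[OF sup fin] sup] card_image[OF assms(1)]
    by (simp add: Compl_eq_Diff_UNIV card_Diff_subset)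
  then obtain g where g: "bij_betw g (- T) (?B - u ` T)"
    using finite_same_card_bij[of "- T" "?B - u ` T"] fin by auto
  define f where "f j = (if j \<in> T then u j else g j)" for j
  define A where "A = (\<chi> i j. f j $ i)"
  have col: "column j A = f j" for j by (simp add: column_def A_def vec_eq_iff)
  have "range f = u ` T \<union> g ` (- T)" by (auto simp: f_def)
  also have "\<dots> = ?B" using g sup by (auto simp: bij_betw_def)
  finally have "columns A = ?B" by (auto simp: columns_def col)
  then have "\<exists>A'. A ** A' = mat 1" using matrix_right_invertible_span_columns[of A] span by simp
  then have "invertible A" by (simp add: invertible_right_inverse)
  moreover have "A *v axis j 1 = u j" if "j \<in> T" for j
    using that by (simp add: vec_eq_iff matrix_vector_axis A_def f_def)
  ultimately show ?thesis by blast
qed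

lemma vec_span_axis:
  fixes K :: "'n::finite set"
  shows "vec.span {axis i 1 | i. i \<in> K} = {v :: 'a::field^'n. \<forall>j. j \<notin> K \<longrightarrow> v $ j = 0}"
proof
  show "vec.span {axis i 1 | i. i \<in> K} \<subseteq> {v :: 'a^'n. \<forall>j. j \<notin> K \<longrightarrow> v $ j = 0}"
    by (rule vec.span_minimal) (auto simp: vec.subspace_def axis_def)
  show "{v :: 'a^'n. \<forall>j. j \<notin> K \<longrightarrow> v $ j = 0} \<subseteq> vec.span {axis i 1 | i. i \<in> K}"
  proof safe
    fix v :: "'a^'n" assume v: "\<forall>j. j \<notin> K \<longrightarrow> v $ j = 0"
    have "v = (\<Sum>i\<in>K. v $ i *s axis i 1)"
      using v by (auto simp: vec_eq_iff axis_def if_distrib sum.delta' cong: if_cong)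
    also have "\<dots> \<in> vec.span {axis i 1 | i. i \<in> K}"
      by (intro vec.span_sum vec.span_scale vec.span_base) auto
    finally show "v \<in> vec.span {axis i 1 | i. i \<in> K}" .
  qed
qed

lemma vec_independent_axis: "vec.independent {axis i (1 :: 'a::field) :: 'a^'n::finite | i. i \<in> K}"
  by (rule vec.independent_mono[OF independent_cart_basis]) (auto simp: cart_basis_def)

text \<open>The columns of \<open>A\<close> at \<open>K\<close> are a basis of the kernel of
  \<open>J\<close>. Then \<open>J ** A\<close> kills these coordinates and is injective on the span
  of the others, whose images become columns of an invertible \<open>C\<close>; \<open>B\<close> is
  the inverse of \<open>C\<close>.\<close>

lemma exists_rank_normal_form:
  fixes J :: "'a::field^'n::finite^'n" and K :: "'n set"
  assumes "card K = vec.dim {v. J *v v = 0}"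
  shows "\<exists>A B. invertible A \<and> invertible B \<and>
    (\<forall>i j. (B ** J ** A) $ i $ j = (if i = j \<and> j \<notin> K then 1 else 0))"
proof -
  let ?V = "{v. J *v v = 0}"
  obtain S where S: "S \<subseteq> ?V" "vec.independent S" "?V \<subseteq> vec.span S" "card S = vec.dim ?V"
    using vec.basis_exists[of ?V] by blast
  then have "finite S" using vec.finiteI_independent by blast
  then obtain u where u: "bij_betw u K S"
    using finite_same_card_bij[of K S] assms S(4) by auto
  then obtain A where A: "invertible A" "\<And>j. j \<in> K \<Longrightarrow> A *v axis j 1 = u j"
    using exists_invertible_with_columns[of u K] S(2) by (auto simp: bij_betw_def)
  define f where "f = J ** A"
  let ?E = "{axis i (1 :: 'a) :: 'a^'n | i. i \<in> - K}"
  have ker: "v = 0" if v: "v \<in> vec.span ?E" "f *v v = 0" for v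
  proof -
    have "vec.span S \<subseteq> {A *v x | x. \<forall>j. j \<notin> K \<longrightarrow> x $ j = 0}"
    proof (rule vec.span_minimal)
      show "S \<subseteq> {A *v x | x. \<forall>j. j \<notin> K \<longrightarrow> x $ j = 0}"
      proof
        fix y assume "y \<in> S"
        then obtain j where j: "j \<in> K" "y = u j" using u by (auto simp: bij_betw_def)
        then have "y = A *v axis j 1" "\<forall>l. l \<notin> K \<longrightarrow> (axis j 1 :: 'a^'n) $ l = 0"
          using A(2) by (auto simp: axis_def)
        then show "y \<in> {A *v x | x. \<forall>j. j \<notin> K \<longrightarrow> x $ j = 0}" by blast
      qed
      have "vec.subspace ((*v) A ` {x. \<forall>j. j \<notin> K \<longrightarrow> x $ j = 0})"
        by (rule vec.linear_subspace_image) (auto simp: vec.subspace_def)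
      then show "vec.subspace {A *v x | x. \<forall>j. j \<notin> K \<longrightarrow> x $ j = 0}"
        by (simp add: image_Collect)
    qed
    moreover have "A *v v \<in> ?V" using v(2) by (simp add: f_def matrix_vector_mul_assoc)
    ultimately obtain x where x: "A *v v = A *v x" "\<forall>j. j \<notin> K \<longrightarrow> x $ j = 0"
      using S(3) by blast
    then have "v = x"
      using A(1) by (metis invertible_def matrix_vector_mul_assoc matrix_vector_mul_lid)
    moreover have "\<forall>j. j \<notin> - K \<longrightarrow> v $ j = 0"
      using v(1) unfolding vec_span_axis by blast
    ultimately show "v = 0" using x(2) unfolding vec_eq_iff by (metis ComplD zero_index)
  qed
  have inj: "inj_on ((*v) f) (vec.span ?E)"
  proof (rule inj_onI)
    fix x y assume "x \<in> vec.span ?E" "y \<in> vec.span ?E" "f *v x = f *v y"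
    then show "x = y" using ker[of "x - y"] by (simp add: vec.span_diff matrix_vector_mult_diff_distrib)
  qed
  have "vec.independent ((*v) f ` ?E)"
    by (rule vec.linear_independent_injective_image[OF _ vec_independent_axis inj]) simp
  moreover have "(\<lambda>j. f *v axis j 1) ` (- K) = (*v) f ` ?E" by blast
  moreover have "inj_on (\<lambda>j. f *v axis j 1) (- K)"
  proof (rule inj_onI)
    fix i j assume ij: "i \<in> - K" "j \<in> - K" and eq: "f *v axis i 1 = f *v axis j 1"
    have "axis i 1 \<in> vec.span ?E" "axis j 1 \<in> vec.span ?E" using ij by (auto intro: vec.span_base)
    then have "axis i (1 :: 'a) = (axis j 1 :: 'a^'n)" using inj eq by (meson inj_onD)
    then show "i = j" by (simp add: axis_eq_axis)
  qed
  ultimately obtain C where C: "invertible C" "\<And>j. j \<notin> K \<Longrightarrow> C *v axis j 1 = f *v axis j 1"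
    using exists_invertible_with_columns[of "\<lambda>j. f *v axis j 1" "- K"] by auto
  then obtain B where B: "C ** B = mat 1" "B ** C = mat 1" by (auto simp: invertible_def)
  have "(B ** J ** A) $ i $ j = (if i = j \<and> j \<notin> K then 1 else 0)" for i j
  proof -
    have "(B ** J ** A) *v axis j 1 = B *v (f *v axis j 1)"
      by (simp add: f_def matrix_vector_mul_assoc matrix_mul_assoc)
    also have "\<dots> = (if j \<notin> K then axis j 1 else 0)"
    proof (cases "j \<in> K")
      case True
      then have "f *v axis j 1 = J *v u j" using A(2) by (simp add: f_def flip: matrix_vector_mul_assoc)
      also have "\<dots> = 0" using S(1) u True by (auto simp: bij_betw_def)
      finally show ?thesis using True by simp
    next
      case False
      then show ?thesis using C(2)[of j] B(2) by (simp add: matrix_vector_mul_assoc flip: C(2))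
    qed
    finally show ?thesis by (simp flip: matrix_vector_axis) (simp add: axis_def)
  qed
  moreover have "invertible B" using B by (auto simp: invertible_def)
  ultimately show ?thesis using A(1) by blast
qed

section \<open>Jacobian at the origin and linear coordinate changes\<close>

lemma ppartial_at_0: "peval (ppartial j p) 0 = lookup p (single j 1)"
proof -
  have "lookup (single (m - single j 1) (of_nat (lookup m j) * lookup p m)) 0 =
      (if m = single j 1 then lookup p m else 0)" for m
  proof (cases "lookup m j = 0")
    \<comment> \<open>Here truncated subtraction may leave the zero monomial although
      \<open>m\<close> is not \<open>single j 1\<close>, but the coefficient contains the factor
      \<open>lookup m j = 0\<close>.\<close>
    case True
    then show ?thesis by (auto simp: lookup_single)
  next
    case False
    have "m = (m - single j 1) + single j 1"
      by (rule poly_mapping_eqI) (use False in \<open>auto simp: lookup_add lookup_minus lookup_single when_def\<close>)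
    then have "m - single j 1 = 0 \<longleftrightarrow> m = single j 1" by (metis add_0 add_right_cancel)
    then show ?thesis by (auto simp: lookup_single when_def)
  qed
  then have "peval (ppartial j p) 0 = (\<Sum>m\<in>keys p. if m = single j 1 then lookup p m else 0)"
    unfolding peval_at_0 ppartial_def lookup_sum by (intro sum.cong) auto
  then show ?thesis by (simp add: in_keys_iff)
qed

lemma jacobian_at_0: "jacobian P 0 $ i $ j = lookup (P $ i) (single j 1)"
  by (simp add: jacobian_def ppartial_at_0)

definition linear_system :: "complex^'n^'n \<Rightarrow> 'n::finite system"
  where "linear_system A = (\<chi> i. \<Sum>j\<in>UNIV. Const (A $ i $ j) * Var j)"

definition const_matrix :: "complex^'n^'n \<Rightarrow> 'n::finite pmatrix"
  where "const_matrix A = (\<chi> i j. Const (A $ i $ j))"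

lemma const_matrix_mult: "const_matrix A ** const_matrix B = const_matrix (A ** B)"
  by (simp add: const_matrix_def matrix_matrix_mult_def vec_eq_iff Const_sum Const_mult)

lemma const_matrix_1: "const_matrix (mat 1) = mat 1"
  by (simp add: const_matrix_def mat_def vec_eq_iff)

lemma linear_system_comp: "sys_comp (linear_system A) (linear_system B) = linear_system (A ** B)"
proof -
  have "sys_comp (linear_system A) (linear_system B) $ i = linear_system (A ** B) $ i" for i
  proof -
    have "sys_comp (linear_system A) (linear_system B) $ i =
        (\<Sum>j\<in>UNIV. \<Sum>k\<in>UNIV. Const (A $ i $ j) * (Const (B $ j $ k) * Var k))"
      by (simp add: linear_system_def psubst_simps sum_distrib_left)
    also have "\<dots> = (\<Sum>k\<in>UNIV. \<Sum>j\<in>UNIV. Const (A $ i $ j) * (Const (B $ j $ k) * Var k))"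
      by (rule sum.swap)
    also have "\<dots> = linear_system (A ** B) $ i"
      by (simp add: linear_system_def matrix_matrix_mult_def Const_sum sum_distrib_right)
    finally show ?thesis .
  qed
  then show ?thesis unfolding vec_eq_iff by blast
qed

lemma linear_system_1: "linear_system (mat 1 :: complex^'n::finite^'n) = sys_id"
proof -
  have "(\<Sum>j\<in>UNIV. Const ((mat 1 :: complex^'n^'n) $ i $ j) * Var j) =
      (\<Sum>j\<in>UNIV. if i = j then Var j else 0)" for i :: 'n
    by (intro sum.cong) (auto simp: mat_def)
  then show ?thesis by (simp add: linear_system_def sys_id_def vec_eq_iff)
qed

lemma peval_linear_system_0: "sys_eval (linear_system A) 0 = 0"
  by (simp add: linear_system_def vec_eq_iff peval_simps)

lemma lookup_Var: "lookup (Var i) (single j 1) = (if i = j then 1 else 0)"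
  by (auto simp: Var_def lookup_single when_def single_single_eq_iff)

lemma single_neq_0: "single j (1::nat) \<noteq> 0" "0 \<noteq> single j (1::nat)"
  by (metis lookup_single_eq lookup_zero one_neq_zero)+

text \<open>The chain rule at the origin: \<open>p\<close> may be replaced by its affine part
  \<open>q\<close>, since a linear substitution keeps the rest in order at least 2.\<close>

lemma lookup_linear_part:
  "lookup (psubst p (linear_system A)) (single j 1) = (\<Sum>i\<in>UNIV. lookup p (single i 1) * A $ i $ j)"
proof -
  define q where "q = Const (lookup p 0) + (\<Sum>i\<in>UNIV. Const (lookup p (single i 1)) * Var i)"
  have "p - q \<in> order_ge 2"
    unfolding weighted_iff
  proof safe
    fix m :: "'a monom" assume "wdeg (\<lambda>_. Suc 0) m < 2"
    then consider "m = 0" | l where "m = single l 1" using mdeg_less_2[of m] by (auto simp: mdeg_wdeg)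
    then show "lookup (p - q) m = 0"
    proof cases
      case 1
      have "lookup (Var i) 0 = 0" for i :: 'a
        by (metis Var_def lookup_single_not_eq single_neq_0(1))
      then show ?thesis by (simp add: 1 q_def lookup_minus lookup_add lookup_Const lookup_sum)
    next
      case 2
      show ?thesis
        unfolding 2 q_def lookup_minus lookup_add lookup_sum lookup_Const_mult lookup_Const lookup_Var
        by (simp add: single_neq_0[simplified] if_distrib[of "(*) _"] cong: if_cong)
    qed
  qed
  then have "psubst (p - q) (linear_system A) \<in> order_ge 2"
    by (rule psubst_weighted[rotated])
      (use peval_linear_system_0[of A] in \<open>simp add: order_ge_1_iff vec_eq_iff peval_at_0\<close>)
  then have "lookup (psubst p (linear_system A)) (single j 1) = lookup (psubst q (linear_system A)) (single j 1)"
    by (simp add: weighted_iff psubst_diff lookup_minus)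
  also have "psubst q (linear_system A) = Const (lookup p 0) +
      (\<Sum>i\<in>UNIV. Const (lookup p (single i 1)) * (\<Sum>k\<in>UNIV. Const (A $ i $ k) * Var k))"
    by (simp add: q_def psubst_simps linear_system_def)
  also have "lookup \<dots> (single j 1) = (\<Sum>i\<in>UNIV. lookup p (single i 1) * A $ i $ j)"
    unfolding lookup_add lookup_sum lookup_Const_mult lookup_Const lookup_Var
    by (simp add: single_neq_0[simplified] if_distrib[of "(*) _"] cong: if_cong)
  finally show ?thesis .
qed

text \<open>By the chain rule the new Jacobian at the origin is
  \<open>B ** jacobian G 0 ** A\<close>, which is brought to diagonal form with zeros exactly at
  \<open>K\<close>.\<close>

lemma exists_linear_normal_form:
  assumes G0: "sys_eval G 0 = 0" and K: "card K = breadth G 0"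
  shows "\<exists>P \<Phi> \<Psi> U V. equivalent_at 0 G P \<Phi> \<Psi> U V \<and> normal_form K 1 1 P"
proof -
  obtain A B where "invertible A" "invertible B" and
    diag: "\<And>i j. (B ** jacobian G 0 ** A) $ i $ j = (if i = j \<and> j \<notin> K then 1 else 0)"
    using exists_rank_normal_form[of K "jacobian G 0"] K by (auto simp: breadth_def jacobian_kernel_def)
  then obtain A' B' where inv: "A ** A' = mat 1" "A' ** A = mat 1" "B ** B' = mat 1" "B' ** B = mat 1"
    by (auto simp: invertible_def)
  define P where "P = const_matrix B *v sys_comp G (linear_system A)"
  have equiv: "equivalent_at 0 G P (linear_system A) (linear_system A') (const_matrix B) (const_matrix B')"
    by (simp add: equivalent_at_def linear_system_comp const_matrix_mult inv linear_system_1
      const_matrix_1 peval_linear_system_0 P_def)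
  have "sys_eval P 0 = 0"
    by (simp add: P_def sys_eval_matrix_vector sys_eval_comp peval_linear_system_0 G0)
  then have P0: "lookup (P $ i) 0 = 0" for i
    by (simp add: vec_eq_iff peval_at_0)
  have P1: "lookup (P $ i) (single j 1) = (if i = j \<and> j \<notin> K then 1 else 0)" for i j
  proof -
    have "lookup (P $ i) (single j 1) =
        (\<Sum>k\<in>UNIV. B $ i $ k * (\<Sum>l\<in>UNIV. lookup (G $ k) (single l 1) * A $ l $ j))"
      by (simp add: P_def const_matrix_def matrix_vector_mult_def lookup_sum lookup_linear_part[simplified])
    also have "\<dots> = (B ** (jacobian G 0 ** A)) $ i $ j"
      by (simp add: matrix_matrix_mult_def jacobian_at_0)
    finally show ?thesis by (simp add: diag matrix_mul_assoc)
  qed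
  have low: "m = 0 \<or> (\<exists>l. m = single l 1)" if "wdeg (\<lambda>_. Suc 0) m < 2" for m :: "'a monom"
    using mdeg_less_2[of m] that by (simp add: mdeg_wdeg)
  have K2: "P $ i \<in> order_ge 2" if "i \<in> K" for i
    unfolding weighted_iff using low P0 P1 that by metis
  have J2: "P $ j - Var j \<in> order_ge 2" if j: "j \<notin> K" for j
    unfolding weighted_iff
  proof safe
    fix m :: "'a monom" assume "wdeg (\<lambda>_. Suc 0) m < 2"
    then consider "m = 0" | l where "m = single l 1" using low by blast
    then show "lookup (P $ j - Var j) m = 0"
    proof cases
      case 1
      have "lookup (Var j) 0 = 0" by (metis Var_def lookup_single_not_eq single_neq_0(1))
      then show ?thesis by (simp add: 1 P0 lookup_minus)
    next
      case 2
      then show ?thesis unfolding 2 lookup_minus lookup_Var P1 using j by auto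
    qed
  qed
  have "1 < mdeg m" if j: "j \<notin> K" "m \<in> keys (P $ j)" "keys m \<subseteq> K" for j m
  proof (rule ccontr)
    assume "\<not> 1 < mdeg m"
    then consider "m = 0" | l where "m = single l 1" using low[of m] by (auto simp: mdeg_wdeg)
    then show False
    proof cases
      case 1
      then show False using j(2) P0 by (simp add: in_keys_iff)
    next
      case 2
      then have "l \<in> K" using j(3) by simp
      then show False using j(2) P1[of j l] unfolding 2 in_keys_iff by auto
    qed
  qed
  moreover have "1 < mdeg m" if "i \<in> K" "m \<in> keys (P $ i)" for i m
    using K2[OF that(1)] that(2) by (auto simp: weighted_def mdeg_wdeg)
  ultimately have "normal_form K 1 1 P"
    unfolding normal_form_def using K2 J2 by blast
  then show ?thesis using equiv by blast
qed

section \<open>Polynomial automorphisms as homeomorphisms\<close>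

lemma peval_differentiable: "(\<lambda>x. peval p x) differentiable (at (a :: complex^'n::finite) within S)"
proof (induction p rule: mpoly_induct)
  case (single m c)
  have comp: "(\<lambda>x :: complex^'n. x $ i) differentiable (at a within S)" for i
    by (rule bounded_linear_imp_differentiable[OF bounded_linear_vec_nth])
  have "(\<lambda>x :: complex^'n. \<Prod>i\<in>A. (x $ i) ^ lookup m i) differentiable (at a within S)" for A
    by (induction A rule: infinite_finite_induct) (simp_all add: comp)
  then show ?case by (simp add: peval_single)
qed (simp add: peval_add)

lemma sys_eval_differentiable: "sys_eval P differentiable (at (a :: complex^'n::finite) within S)"
proof -
  have "linear (axis i :: complex \<Rightarrow> complex^'n)" for i
    by (rule linearI) (auto simp: axis_def vec_eq_iff)
  then have "bounded_linear (axis i :: complex \<Rightarrow> complex^'n)" for i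
    by (simp add: linear_conv_bounded_linear)
  then have "(\<lambda>x. axis i (peval (P $ i) x) :: complex^'n) differentiable (at a within S)" for i
    by (intro differentiable_compose[OF bounded_linear_imp_differentiable peval_differentiable])
  then have "(\<lambda>x. \<Sum>i\<in>UNIV. axis i (peval (P $ i) x) :: complex^'n) differentiable (at a within S)"
    by simp
  moreover have "(\<lambda>x. \<Sum>i\<in>UNIV. axis i (peval (P $ i) x)) = sys_eval P"
    by (auto simp: fun_eq_iff vec_eq_iff axis_def if_distrib cong: if_cong)
  ultimately show ?thesis by simp
qed

lemma sys_eval_continuous: "continuous_on S (sys_eval P)"
  by (rule differentiable_imp_continuous_on) (simp add: differentiable_on_def sys_eval_differentiable)

lemma sys_eval_inverse:
  "sys_comp \<Phi> \<Psi> = sys_id \<Longrightarrow> sys_eval \<Phi> (sys_eval \<Psi> x) = x"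
  by (metis sys_eval_comp sys_eval_id)

lemma locally_invertible_automorphism:
  assumes "sys_comp \<Phi> \<Psi> = sys_id" "sys_comp \<Psi> \<Phi> = sys_id"
  shows "locally_invertible_at (sys_eval \<Phi>) a"
proof -
  have "homeomorphism UNIV UNIV (sys_eval \<Phi>) (sys_eval \<Psi>)"
    using sys_eval_inverse[OF assms(1)] sys_eval_inverse[OF assms(2)] sys_eval_continuous
    by (intro homeomorphismI) auto
  then show ?thesis
    unfolding locally_invertible_at_def
    using sys_eval_differentiable[of \<Psi>] by (intro exI[of _ UNIV] exI[of _ "sys_eval \<Psi>"]) (auto simp: differentiable_on_def)
qed

lemma mat_eval_invertible:
  assumes "U ** V = mat 1"
  shows "invertible (mat_eval U x)"
  using mat_eval_mult[of U V x] assms by (auto simp: mat_eval_1 invertible_right_inverse)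

text \<open>\<open>U\<close> has a polynomial inverse, so its value is invertible at every point and
  the zeros of \<open>P\<close> are exactly the preimages under \<open>\<Phi>\<close> of those of
  \<open>G\<close>. Continuity and injectivity of \<open>\<Phi>\<close> transport isolation.\<close>

lemma equivalent_at_0_isolated_zero:
  assumes equiv: "equivalent_at 0 G P \<Phi> \<Psi> U V" and iso: "isolated_zero G 0"
  shows "isolated_zero P 0"
proof -
  have *: "sys_comp \<Psi> \<Phi> = sys_id" "U ** V = mat 1" "V ** U = mat 1"
    "sys_eval \<Phi> 0 = 0" "P = U *v sys_comp G \<Phi>"
    using equiv by (auto simp: equivalent_at_def)
  have zero: "sys_eval P x = 0 \<longleftrightarrow> sys_eval G (sys_eval \<Phi> x) = 0" for x
  proof -
    have "mat_eval V x ** mat_eval U x = mat 1"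
      using mat_eval_mult[of V U x] *(3) by (simp add: mat_eval_1)
    then have "mat_eval U x *v y = 0 \<longleftrightarrow> y = 0" for y
      by (metis matrix_vector_mul_assoc matrix_vector_mul_lid matrix_vector_mult_0_right)
    then show ?thesis by (simp add: *(5) sys_eval_matrix_vector sys_eval_comp)
  qed
  obtain T where T: "open T" "T \<inter> {x. sys_eval G x = 0} = {0}"
    using iso by (auto simp: isolated_zero_def isolated_in_def)
  have "open (sys_eval \<Phi> -` T)"
    using open_vimage[OF T(1) sys_eval_continuous] .
  moreover have "sys_eval \<Phi> -` T \<inter> {x. sys_eval P x = 0} = {0}"
  proof (intro equalityI subsetI)
    fix x assume "x \<in> sys_eval \<Phi> -` T \<inter> {x. sys_eval P x = 0}"
    then have "sys_eval \<Phi> x = 0" using T(2) zero by blast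
    then have "x = 0" using sys_eval_inverse[OF *(1), of x] sys_eval_inverse[OF *(1), of 0] *(4) by simp
    then show "x \<in> {0}" by simp
  next
    fix x :: "complex^'a" assume "x \<in> {0}"
    then show "x \<in> sys_eval \<Phi> -` T \<inter> {x. sys_eval P x = 0}"
      using T(2) zero *(4) by auto
  qed
  moreover have "sys_eval P 0 = 0" using T(2) zero *(4) by auto
  ultimately show ?thesis unfolding isolated_zero_def isolated_in_def by blast
qed

section \<open>Translation to the origin, kernel of a normal form and conclusion\<close>

lemma equivalent_at_translation:
  "equivalent_at z G (sys_comp G (translation z)) (translation z) (translation (- z)) (mat 1) (mat 1)"
  by (simp add: equivalent_at_def translation_def vec_eq_iff sys_id_def psubst_simps peval_simps Const_uminus)

lemma jacobian_kernel_normal_form: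
  assumes nf: "normal_form K k l P"
  shows "jacobian_kernel P 0 = vec.span {axis i 1 | i. i \<in> K}"
proof -
  have "jacobian P 0 $ i $ j = (if i = j \<and> j \<notin> K then 1 else 0)" for i j
  proof (cases "i \<in> K")
    case True
    then have "P $ i \<in> order_ge 2" using nf by (simp add: normal_form_def)
    then show ?thesis using True by (auto simp: jacobian_at_0 weighted_iff)
  next
    case False
    then have "P $ i - Var i \<in> order_ge 2" using nf by (simp add: normal_form_def)
    then have "lookup (P $ i - Var i) (single j 1) = 0" by (simp add: weighted_iff)
    then show ?thesis using False lookup_Var[of i j] by (auto simp: jacobian_at_0 lookup_minus)
  qed
  then have "(\<Sum>j\<in>UNIV. jacobian P 0 $ i $ j * v $ j) =
      (\<Sum>j\<in>UNIV. if i = j then if i \<in> K then 0 else v $ i else 0)" for i v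
    by (intro sum.cong) auto
  then have "jacobian P 0 *v v = (\<chi> i. if i \<in> K then 0 else v $ i)" for v
    by (simp add: vec_eq_iff matrix_vector_mult_def)
  then show ?thesis
    unfolding jacobian_kernel_def vec_span_axis by (auto simp: vec_eq_iff)
qed

lemma card_pos_less:
  assumes "\<kappa> \<le> CARD('n::{finite,linorder})"
  shows "card {i :: 'n. pos i < \<kappa>} = \<kappa>"
proof -
  have mono: "pos i < pos j" if "i < j" for i j :: 'n
    unfolding pos_def using that by (intro psubset_card_mono) auto
  then have inj: "inj (pos :: 'n \<Rightarrow> nat)"
    by (intro injI) (metis less_irrefl linorder_neqE)
  have "pos i < CARD('n)" for i :: 'n
    unfolding pos_def by (intro psubset_card_mono) auto
  then have "range (pos :: 'n \<Rightarrow> nat) \<subseteq> {..<CARD('n)}" by auto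
  then have "range (pos :: 'n \<Rightarrow> nat) = {..<CARD('n)}"
    by (rule card_subset_eq[rotated]) (simp_all add: card_image[OF inj])
  then have "pos ` {i :: 'n. pos i < \<kappa>} = {..<\<kappa>}"
    using assms by (auto simp: image_iff set_eq_iff) (metis less_le_trans)
  moreover have "card (pos ` {i :: 'n. pos i < \<kappa>}) = card {i :: 'n. pos i < \<kappa>}"
    by (rule card_image) (use inj in \<open>auto simp: inj_on_def\<close>)
  ultimately show ?thesis by simp
qed

theorem theorem2p1:
  fixes le :: "('n::{finite,linorder}) monom \<Rightarrow> 'n monom \<Rightarrow> bool"
    and G :: "'n system" and z :: "'n point" and \<kappa> d :: nat
  assumes "graded_local_order le"
    and "sys_eval G z = 0"
    and "regular_zero le \<kappa> d G z"
  shows "\<exists>(\<Phi> :: 'n system) (U :: 'n pmatrix) (P :: 'n system).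
    sys_eval \<Phi> 0 = z \<and> locally_invertible_at (sys_eval \<Phi>) 0 \<and>
    invertible (mat_eval U 0) \<and>
    P = U *v sys_comp G \<Phi> \<and>
    regular_zero_at_origin le \<kappa> d P \<and>
    pre_inflatable \<kappa> d d P \<and>
    (\<forall>i. pos i < \<kappa> \<longrightarrow> P $ i \<noteq> 0 \<and> initial_degree (P $ i) = d) \<and>
    \<not> (\<exists>x :: 'n point. (\<forall>i. \<kappa> \<le> pos i \<longrightarrow> x $ i = 0) \<and> norm x = 1 \<and>
           (\<forall>i. pos i < \<kappa> \<longrightarrow> peval (initial_form (P $ i)) x = 0)) \<and>
    (\<forall>i. \<kappa> \<le> pos i \<longrightarrow> initial_form (P $ i) = Var i)"
proof -
  interpret monomial_order le by unfold_locales (rule assms(1))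
  define K where "K = {i :: 'n. pos i < \<kappa>}"
  define G0 where "G0 = sys_comp G (translation z)"
  have reg: "isolated_zero G0 0" "breadth G0 0 = \<kappa>"
      "hilbert_series le (sys_ideal G0) = (\<Sum>i<d. fps_X ^ i) ^ \<kappa>"
    using assms(3) by (simp_all add: regular_zero_def regular_zero_at_origin_def G0_def)
  have "\<kappa> \<le> CARD('n)"
    using dim_subset_UNIV_cart_gen[of "jacobian_kernel G0 0"] reg(2) by (simp add: breadth_def)
  then have K: "card K = \<kappa>" unfolding K_def by (rule card_pos_less)
  have G0: "equivalent_at z G G0 (translation z) (translation (- z)) (mat 1) (mat 1)"
    unfolding G0_def by (rule equivalent_at_translation)
  have "sys_eval G0 0 = 0"
    using reg(1) by (auto simp: isolated_zero_def isolated_in_def)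
  then obtain P1 \<Phi>1 \<Psi>1 U1 V1 where 1: "equivalent_at 0 G0 P1 \<Phi>1 \<Psi>1 U1 V1" "normal_form K 1 1 P1"
    using exists_linear_normal_form[of G0 K] K reg(2) by auto
  obtain P \<Phi>2 \<Psi>2 U2 V2 where 2: "equivalent_at 0 P1 P \<Phi>2 \<Psi>2 U2 V2"
      and nf: "normal_form K d d P"
    using exists_normal_form[OF 1(2), of d] by auto
  \<comment> \<open>Two composites are kept: the one from \<open>G0\<close> fixes the origin and
    transports the Hilbert series and isolation, the one from \<open>G\<close> supplies the
    transformation and the matrix.\<close>
  obtain \<Phi>0 \<Psi>0 U0 V0 where G0P: "equivalent_at 0 G0 P \<Phi>0 \<Psi>0 U0 V0"
    using equivalent_at_trans[OF 1(1) 2] by blast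
  obtain \<Phi> \<Psi> U V where GP: "equivalent_at z G P \<Phi> \<Psi> U V"
    using equivalent_at_trans[OF G0 G0P] by blast
  have hs: "hilbert_series le (sys_ideal P) = (\<Sum>i<d. fps_X ^ i) ^ \<kappa>"
    using equivalent_at_0_hilbert_series[OF G0P] reg(3) by simp
  interpret normal_system le K d P
    by unfold_locales (use nf hs hilbert_series_eq_iff[of le "sys_ideal P" d K] K in auto)
  have kernel: "jacobian_kernel P 0 = vec.span {axis i 1 | i. i \<in> K}"
    by (rule jacobian_kernel_normal_form[OF nf])
  have iso: "isolated_zero P 0"
    by (rule equivalent_at_0_isolated_zero[OF G0P reg(1)])
  have "inj (\<lambda>i. axis i 1 :: 'n point)"
    by (auto intro: injI simp: axis_eq_axis)
  then have "card {axis i 1 :: 'n point | i. i \<in> K} = card K"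
    using card_image[of "\<lambda>i. axis i 1 :: 'n point" K] by (simp add: Setcompr_eq_image inj_on_subset)
  then have breadth: "breadth P 0 = \<kappa>"
    using vec.dim_eq_card_independent[OF vec_independent_axis[where 'a = complex and K = K]] K
    by (simp add: breadth_def kernel vec.dim_span)
  have supp: "keys m \<subseteq> K \<longleftrightarrow> (\<forall>j. \<kappa> \<le> pos j \<longrightarrow> lookup m j = 0)" for m :: "'n monom"
    by (auto simp: K_def subset_iff in_keys_iff not_less[symmetric])
  have pre: "pre_inflatable \<kappa> d d P"
    unfolding pre_inflatable_def
    using \<open>\<kappa> \<le> CARD('n)\<close> iso kernel nfD(3,4) supp by (auto simp: K_def not_less)
  have degree: "P $ i \<noteq> 0 \<and> initial_degree (P $ i) = d" if "i \<in> K" for i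
    using initial_degree_eq[OF that] exists_degree_d[OF that] by auto
  have no_zero: "\<not> (\<exists>x :: 'n point. (\<forall>i. \<kappa> \<le> pos i \<longrightarrow> x $ i = 0) \<and> norm x = 1 \<and>
      (\<forall>i. pos i < \<kappa> \<longrightarrow> peval (initial_form (P $ i)) x = 0))"
  proof safe
    fix x :: "'n point"
    assume "\<forall>i. \<kappa> \<le> pos i \<longrightarrow> x $ i = 0" "norm x = 1"
      "\<forall>i. pos i < \<kappa> \<longrightarrow> peval (initial_form (P $ i)) x = 0"
    \<comment> \<open>Norm 1 makes \<open>x\<close> nonzero.\<close>
    then show False
      by (intro initial_forms_no_common_zero[of x]) (auto simp: K_def)
  qed
  show ?thesis
  proof (intro exI conjI)
    show "sys_eval \<Phi> 0 = z" "P = U *v sys_comp G \<Phi>"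
      using GP by (simp_all add: equivalent_at_def)
    show "locally_invertible_at (sys_eval \<Phi>) 0"
      using GP locally_invertible_automorphism by (auto simp: equivalent_at_def)
    show "invertible (mat_eval U 0)"
      using GP mat_eval_invertible by (auto simp: equivalent_at_def)
    show "regular_zero_at_origin le \<kappa> d P"
      by (simp add: regular_zero_at_origin_def iso breadth hs)
    show "pre_inflatable \<kappa> d d P" by (rule pre)
    show "\<forall>i. pos i < \<kappa> \<longrightarrow> P $ i \<noteq> 0 \<and> initial_degree (P $ i) = d"
      using degree by (simp add: K_def)
    show "\<forall>i. \<kappa> \<le> pos i \<longrightarrow> initial_form (P $ i) = Var i"
      using initial_form_Var by (simp add: K_def)
  qed (rule no_zero)
qed

end
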